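(* Let $(X,T)$ be a non-periodic transitive dynamical system which has the shadowing property. Then: (1) if $(X,T)$ has a fixed point, then there exists a dense Mycielski subset $K$ of $X$ such that for every $n\ge 2$ there is some $\delta_n>0$ for which $K$ is distributionally $n$-$\delta_n$-scrambled; (2) if $(X,T)$ has a periodic point, then there exists a Mycielski subset $K$ of $X$ such that for every $n\ge 2$ there is some $\delta_n>0$ for which $K$ is distributionally $n$-$\delta_n$-scrambled. In particular, every Devaney chaotic dynamical system with the shadowing property is distributionally chaotic.
   Context: A dynamical system $(X,T)$ is a (non-empty) compact metric space $(X,d)$ together with a continuous map $T\colon X\to X$. $\mathbb{N}=\{1,2,\dots\}$ and $\mathbb{Z}_+=\{0,1,2,\dots\}$. Transitive: for every two non-empty open $U,V\subset X$ there is $n\in\mathbb{N}$ with $T^nU\cap V\ne\emptyset$. A transitive system is non-periodic if $X$ does not consist of just one periodic orbit. Shadowing property: for every $\varepsilon>0$ there is $\delta>0$ such that every sequence $\{x_n\}_{n=0}^\infty$ in $X$ with $d(x_{n+1},Tx_n)<\delta$ for all $n\in\mathbb{Z}_+$ (a $\delta$-pseudo-orbit) is $\varepsilon$-traced by some $x\in X$, i.e. $d(T^nx,x_n)<\varepsilon$ for all $n\in\mathbb{Z}_+$. A Cantor set is a subset of $X$ homeomorphic to the standard Cantor ternary set; a Mycielski set is a subset that is a union of countably many (at least one) Cantor sets. The upper density of $F\subset\mathbb{Z}_+$ is $\overline{d}(F)=\limsup_{m\to\infty}\frac1m\#(F\cap\{0,1,\dots,m-1\})$. For $n\ge2$ and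 $\delta>0$, a set $C\subset X$ is distributionally $n$-$\delta$-scrambled if for any pairwise distinct points $x_1,\dots,x_n\in C$: (i) for every $t>0$, the set $\{k\in\mathbb{Z}_+\colon d(T^kx_i,T^kx_j)<t \text{ for all } 1\le i<j\le n\}$ has upper density one; and (ii) the set $\{k\in\mathbb{Z}_+\colon d(T^kx_i,T^kx_j)>\delta \text{ for all } 1\le i<j\le n\}$ has upper density one. (The constant $\delta$ is the same for all $n$-tuples of distinct points of $C$.) Devaney chaotic: $(X,T)$ is transitive, its set of periodic points is dense in $X$, and it has sensitive dependence on initial conditions, i.e. there is $\delta>0$ such that for each $x\in X$ and $\varepsilon>0$ there are $y\in X$ with $d(x,y)<\varepsilon$ and $k\in\mathbb{N}$ with $d(T^kx,T^ky)>\delta$. Distributionally chaotic: for $x,y\in X$, $n\in\mathbb{N}$ and $t\in\mathbb{R}$ put $\Phi^n_{xy}(t)=\frac1n\#\{0\le i\le n-1\colon d(T^ix,T^iy)<t\}$. The system is distributionally chaotic if there is an uncountable $S\subset X$ such that for every two distinct $x,y\in S$: for every $t>0$, $\limsup_{n\to\infty}\Phi^n_{xy}(t)=1$, and there exists $\delta>0$ with $\liminf_{n\to\infty}\Phi^n_{xy}(\delta)=0$. *)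

theory Defs
  imports "HOL-Analysis.Analysis"
begin

text \<open>
  A compact metric space is modelled as a compact subset \<open>X\<close> of a type of class
  \<open>metric_space\<close>, with the induced metric. Only the values of \<open>T\<close> on \<open>X\<close> matter. This
  loses no generality: every compact metric space embeds isometrically into a space of
  bounded real functions.
\<close>

definition dynamical_system :: "'a::metric_space set \<Rightarrow> ('a \<Rightarrow> 'a) \<Rightarrow> bool" where
  "dynamical_system X T \<longleftrightarrow> X \<noteq> {} \<and> compact X \<and> continuous_on X T \<and> T ` X \<subseteq> X"

definition topologically_transitive :: "'a::metric_space set \<Rightarrow> ('a \<Rightarrow> 'a) \<Rightarrow> bool" where
  "topologically_transitive X T \<longleftrightarrow>
     (\<forall>U V. openin (top_of_set X) U \<and> U \<noteq> {} \<and> openin (top_of_set X) V \<and> V \<noteq> {} \<longrightarrow>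
        (\<exists>n\<ge>1. (T ^^ n) ` U \<inter> V \<noteq> {}))"

definition fixed_points :: "'a set \<Rightarrow> ('a \<Rightarrow> 'a) \<Rightarrow> 'a set" where
  "fixed_points X T = {p \<in> X. T p = p}"

definition periodic_points :: "'a set \<Rightarrow> ('a \<Rightarrow> 'a) \<Rightarrow> 'a set" where
  "periodic_points X T = {p \<in> X. \<exists>n\<ge>1. (T ^^ n) p = p}"

definition forward_orbit :: "('a \<Rightarrow> 'a) \<Rightarrow> 'a \<Rightarrow> 'a set" where
  "forward_orbit T x = range (\<lambda>n. (T ^^ n) x)"

definition non_periodic :: "'a set \<Rightarrow> ('a \<Rightarrow> 'a) \<Rightarrow> bool" where
  "non_periodic X T \<longleftrightarrow> \<not> (\<exists>p \<in> periodic_points X T. X = forward_orbit T p)"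

definition pseudo_orbit ::
    "'a::metric_space set \<Rightarrow> ('a \<Rightarrow> 'a) \<Rightarrow> real \<Rightarrow> (nat \<Rightarrow> 'a) \<Rightarrow> bool" where
  "pseudo_orbit X T \<delta> x \<longleftrightarrow> (\<forall>n. x n \<in> X) \<and> (\<forall>n. dist (x (Suc n)) (T (x n)) < \<delta>)"

definition shadowing :: "'a::metric_space set \<Rightarrow> ('a \<Rightarrow> 'a) \<Rightarrow> bool" where
  "shadowing X T \<longleftrightarrow>
     (\<forall>\<epsilon>>0. \<exists>\<delta>>0. \<forall>x. pseudo_orbit X T \<delta> x \<longrightarrow>
        (\<exists>z\<in>X. \<forall>n. dist ((T ^^ n) z) (x n) < \<epsilon>))"

text \<open>The standard Cantor ternary set: the reals in the unit interval that have a base 3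
  expansion with digits 0 and 2 only.\<close>

definition cantor_ternary_set :: "real set" where
  "cantor_ternary_set =
     {x. \<exists>a :: nat \<Rightarrow> real. (\<forall>n. a n \<in> {0, 2}) \<and> (\<lambda>n. a n / 3 ^ Suc n) sums x}"

definition cantor_subset :: "'a::metric_space set \<Rightarrow> 'a set \<Rightarrow> bool" where
  "cantor_subset X C \<longleftrightarrow> C \<subseteq> X \<and> C homeomorphic cantor_ternary_set"

definition mycielski_subset :: "'a::metric_space set \<Rightarrow> 'a set \<Rightarrow> bool" where
  "mycielski_subset X K \<longleftrightarrow>
     (\<exists>\<C>. countable \<C> \<and> \<C> \<noteq> {} \<and> (\<forall>C\<in>\<C>. cantor_subset X C) \<and> K = \<Union>\<C>)"

definition upper_density :: "nat set \<Rightarrow> ereal" where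
  "upper_density F = limsup (\<lambda>m. ereal (real (card (F \<inter> {..<m})) / real m))"

definition distributionally_scrambled ::
    "'a::metric_space set \<Rightarrow> ('a \<Rightarrow> 'a) \<Rightarrow> nat \<Rightarrow> real \<Rightarrow> 'a set \<Rightarrow> bool" where
  "distributionally_scrambled X T n \<delta> C \<longleftrightarrow> C \<subseteq> X \<and>
     (\<forall>x :: nat \<Rightarrow> 'a. x ` {1..n} \<subseteq> C \<and> inj_on x {1..n} \<longrightarrow>
        (\<forall>t>0. upper_density {k. \<forall>i\<in>{1..n}. \<forall>j\<in>{1..n}. i < j \<longrightarrow>
                   dist ((T ^^ k) (x i)) ((T ^^ k) (x j)) < t} = 1) \<and>
        upper_density {k. \<forall>i\<in>{1..n}. \<forall>j\<in>{1..n}. i < j \<longrightarrow>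
                   dist ((T ^^ k) (x i)) ((T ^^ k) (x j)) > \<delta>} = 1)"

definition sensitive :: "'a::metric_space set \<Rightarrow> ('a \<Rightarrow> 'a) \<Rightarrow> bool" where
  "sensitive X T \<longleftrightarrow>
     (\<exists>\<delta>>0. \<forall>x\<in>X. \<forall>\<epsilon>>0. \<exists>y\<in>X. dist x y < \<epsilon> \<and>
        (\<exists>k\<ge>1. dist ((T ^^ k) x) ((T ^^ k) y) > \<delta>))"

definition devaney_chaotic :: "'a::metric_space set \<Rightarrow> ('a \<Rightarrow> 'a) \<Rightarrow> bool" where
  "devaney_chaotic X T \<longleftrightarrow>
     topologically_transitive X T \<and> X \<subseteq> closure (periodic_points X T) \<and> sensitive X T"

definition close_frequency ::
    "('a::metric_space \<Rightarrow> 'a) \<Rightarrow> nat \<Rightarrow> 'a \<Rightarrow> 'a \<Rightarrow> real \<Rightarrow> real" where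
  "close_frequency T n x y t =
     real (card {i. i < n \<and> dist ((T ^^ i) x) ((T ^^ i) y) < t}) / real n"

definition distributionally_chaotic :: "'a::metric_space set \<Rightarrow> ('a \<Rightarrow> 'a) \<Rightarrow> bool" where
  "distributionally_chaotic X T \<longleftrightarrow>
     (\<exists>S\<subseteq>X. uncountable S \<and>
        (\<forall>x\<in>S. \<forall>y\<in>S. x \<noteq> y \<longrightarrow>
           (\<forall>t>0. limsup (\<lambda>n. ereal (close_frequency T n x y t)) = 1) \<and>
           (\<exists>\<delta>>0. liminf (\<lambda>n. ereal (close_frequency T n x y \<delta>)) = 0)))"

end

theory Submission
  imports Defs
begin

text \<open>
The reason for the chaos is a supply of pseudo-orbits. Let \<open>p\<close> be a periodic point of period
\<open>P\<close>. Transitivity joins any two points by a \<open>\<delta>\<close>-chain, so finitely many pseudo-orbits can start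
at prescribed points, be brought to \<open>p\<close> at one common time, and follow the orbit of \<open>p\<close> from
then on: the orbits that shadow them stay close to each other with frequency as near to one as
desired. Instead, after the common time, the \<open>i\<close>-th pseudo-orbit can wait \<open>i\<close> further periods at
\<open>p\<close> and then go over to one fixed orbit, that of \<open>z\<close>. The pseudo-orbits then follow the shifts
of the orbit of \<open>z\<close> by the multiples of \<open>P\<close> up to \<open>n * P\<close>. So it is enough that \<open>z\<close> stays
uniformly apart from these shifts, and that is where non-periodicity enters: some point \<open>q\<close> is
not on the orbit of \<open>p\<close>, and \<open>z\<close> shadows a closed pseudo-orbit that waits a long time at \<open>p\<close>
and then visits \<open>q\<close>. If the orbit of \<open>z\<close> came very close to its shift by some small \<open>c\<close>, it
would be almost \<open>c\<close>-periodic for a whole round, and the visit to \<open>q\<close> could be moved back in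
steps of \<open>c\<close> into the waiting time, which puts \<open>q\<close> near the orbit of \<open>p\<close>
(\<open>orbit_with_separated_shifts\<close>).

The common arrival time needs chains to \<open>p\<close> whose length is a multiple of \<open>P\<close>. For a fixed point
this is no condition. In general the length modulo \<open>P\<close> is controlled on a non-empty open set
\<open>D\<close>, after \<open>p\<close> is replaced by another point of its orbit (\<open>anchored_periodic_point\<close>). This is
why the set is dense when there is a fixed point, where \<open>D\<close> is the whole space, and only
dense in \<open>D\<close> otherwise.

Thus \<open>n\<close>-tuples of points of \<open>D\<close> are generically close, and generically separated by a constant
depending only on \<open>n\<close>, for a proportion of time above \<open>1 - 1/(s+1)\<close>
(\<open>generically_often_close\<close>, \<open>generically_often_separated\<close>). Mycielski's argument turns countably
many generic conditions on tuples into one set all of whose injective tuples satisfy them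
(\<open>mycielski_parametrisation\<close>): a family of points indexed by a natural number and a binary
sequence is built by successive approximation, where stage \<open>s\<close> deals with all tuples of labels
that can be told apart by \<open>s\<close> digits. For a fixed natural number the binary sequences give a
Cantor set.
\<close>

section \<open>Pseudo-orbits\<close>

definition chain ::
    "'a::metric_space set \<Rightarrow> ('a \<Rightarrow> 'a) \<Rightarrow> real \<Rightarrow> nat \<Rightarrow> (nat \<Rightarrow> 'a) \<Rightarrow> bool" where
  "chain X T \<delta> m f \<longleftrightarrow> (\<forall>i\<le>m. f i \<in> X) \<and> (\<forall>i<m. dist (f (Suc i)) (T (f i)) < \<delta>)"

definition splice_at :: "nat \<Rightarrow> (nat \<Rightarrow> 'a) \<Rightarrow> (nat \<Rightarrow> 'a) \<Rightarrow> nat \<Rightarrow> 'a" where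
  "splice_at m f g = (\<lambda>i. if i < m then f i else g (i - m))"

lemma splice_at_add [simp]: "splice_at m f g (m + k) = g k"
  by (simp add: splice_at_def)

lemma splice_at_0: "f m = g 0 \<Longrightarrow> splice_at m f g 0 = f 0"
  by (cases m) (simp_all add: splice_at_def)

lemma splice_at_step:
  assumes "chain X T \<delta> m f" "f m = g 0" "m \<le> i \<Longrightarrow> dist (g (Suc (i - m))) (T (g (i - m))) < \<delta>"
  shows "dist (splice_at m f g (Suc i)) (T (splice_at m f g i)) < \<delta>"
proof -
  consider "Suc i < m" | "Suc i = m" | "m \<le> i" by linarith
  then show ?thesis
  proof cases
    case 2
    then have "splice_at m f g (Suc i) = f (Suc i)" using assms(2) by (simp add: splice_at_def)
    moreover have "splice_at m f g i = f i" "i < m" using 2 by (auto simp: splice_at_def)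
    ultimately show ?thesis using assms(1) by (simp add: chain_def)
  next
    case 3
    then have "Suc i - m = Suc (i - m)" by simp
    then show ?thesis using assms(3) 3 by (simp add: splice_at_def)
  qed (use assms in \<open>simp add: splice_at_def chain_def\<close>)
qed

lemma chain_splice:
  assumes "chain X T \<delta> m f" "chain X T \<delta> l g" "f m = g 0"
  shows "chain X T \<delta> (m + l) (splice_at m f g)"
  unfolding chain_def
proof (intro conjI allI impI)
  show "splice_at m f g i \<in> X" if "i \<le> m + l" for i
    using assms(1,2) that by (auto simp: splice_at_def chain_def)
  show "dist (splice_at m f g (Suc i)) (T (splice_at m f g i)) < \<delta>" if "i < m + l" for i
    using assms that by (intro splice_at_step) (auto simp: chain_def)
qed

lemma pseudo_orbit_splice:
  assumes "chain X T \<delta> m f" "pseudo_orbit X T \<delta> g" "f m = g 0"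
  shows "pseudo_orbit X T \<delta> (splice_at m f g)"
  unfolding pseudo_orbit_def
proof (intro conjI allI)
  show "splice_at m f g i \<in> X" for i
    using assms(1,2) by (auto simp: splice_at_def chain_def pseudo_orbit_def)
  show "dist (splice_at m f g (Suc i)) (T (splice_at m f g i)) < \<delta>" for i
    using assms by (intro splice_at_step) (auto simp: pseudo_orbit_def)
qed

lemma pseudo_orbit_imp_chain: "pseudo_orbit X T \<delta> f \<Longrightarrow> chain X T \<delta> m f"
  by (simp add: pseudo_orbit_def chain_def)

lemma chain_loop_pseudo_orbit:
  assumes "chain X T \<delta> L f" "f L = f 0" "L > 0"
  shows "pseudo_orbit X T \<delta> (\<lambda>k. f (k mod L))"
  unfolding pseudo_orbit_def
proof (intro conjI allI)
  show "f (k mod L) \<in> X" for k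
    using assms by (simp add: chain_def less_imp_le)
  show "dist (f (Suc k mod L)) (T (f (k mod L))) < \<delta>" for k
  proof -
    have "f (Suc k mod L) = f (Suc (k mod L))"
      using assms(2) by (simp add: mod_Suc)
    then show ?thesis using assms by (simp add: chain_def)
  qed
qed

lemma funpow_mult_fixed: "(T ^^ m) p = p \<Longrightarrow> m dvd k \<Longrightarrow> (T ^^ k) p = p"
proof -
  assume a: "(T ^^ m) p = p" "m dvd k"
  then obtain j where k: "k = m * j" by blast
  show ?thesis unfolding k funpow_mult[symmetric]
    using a(1) by (induction j) auto
qed

lemma finite_forward_orbit:
  assumes "(T ^^ P) p = p" "P > 0"
  shows "finite (forward_orbit T p)"
proof -
  have "(T ^^ k) p = (T ^^ (k mod P)) p" for k
    by (rule funpow_mod_eq[OF assms(1), symmetric])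
  then have "(T ^^ k) p \<in> (\<lambda>k. (T ^^ k) p) ` {..<P}" for k
    using assms(2) by (metis imageI lessThan_iff mod_less_divisor)
  then have "forward_orbit T p \<subseteq> (\<lambda>k. (T ^^ k) p) ` {..<P}"
    unfolding forward_orbit_def by blast
  then show ?thesis using finite_surj by blast
qed

lemma funpow_apply_add: "(T ^^ m) ((T ^^ n) x) = (T ^^ (m + n)) x"
  by (simp add: funpow_add)

locale dyn_system =
  fixes X :: "'a::metric_space set" and T :: "'a \<Rightarrow> 'a"
  assumes dyn: "dynamical_system X T"
begin

lemma nonempty: "X \<noteq> {}" and compact: "compact X" and cont: "continuous_on X T"
    and invariant: "x \<in> X \<Longrightarrow> T x \<in> X"
  using dyn unfolding dynamical_system_def by auto

lemma funpow_in: "x \<in> X \<Longrightarrow> (T ^^ k) x \<in> X"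
  by (induction k) (auto simp: invariant)

lemma continuous_on_funpow: "continuous_on X (T ^^ k)"
proof (induction k)
  case 0
  then show ?case by (simp add: id_def)
next
  case (Suc k)
  have "continuous_on ((T ^^ k) ` X) T"
    using cont by (rule continuous_on_subset) (auto simp: funpow_in)
  from continuous_on_compose[OF Suc this] show ?case by (simp add: comp_def)
qed

text \<open>
Iterates of bounded order are controlled together; this is what makes conditions on an initial
segment of the orbits open conditions on the starting points.
\<close>

lemma equicontinuous_funpow:
  assumes "e > 0"
  shows "\<exists>d>0. \<forall>u\<in>X. \<forall>v\<in>X. dist u v < d \<longrightarrow> (\<forall>k\<le>m. dist ((T ^^ k) u) ((T ^^ k) v) < e)"
proof (induction m)
  case 0
  then show ?case using assms by auto
next
  case (Suc m)
  then obtain d where d: "d > 0"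
    "\<And>u v k. u \<in> X \<Longrightarrow> v \<in> X \<Longrightarrow> dist u v < d \<Longrightarrow> k \<le> m \<Longrightarrow> dist ((T ^^ k) u) ((T ^^ k) v) < e"
    by blast
  have "uniformly_continuous_on X (T ^^ Suc m)"
    using compact_uniformly_continuous continuous_on_funpow compact by blast
  then obtain d' where d': "d' > 0"
    "\<And>u v. u \<in> X \<Longrightarrow> v \<in> X \<Longrightarrow> dist u v < d' \<Longrightarrow> dist ((T ^^ Suc m) u) ((T ^^ Suc m) v) < e"
    using assms unfolding uniformly_continuous_on_def by (metis dist_commute)
  show ?case
    using d d' by (intro exI[of _ "min d d'"]) (auto simp del: funpow.simps simp: le_Suc_eq)
qed

lemma pseudo_orbit_orbit: "x \<in> X \<Longrightarrow> \<delta> > 0 \<Longrightarrow> pseudo_orbit X T \<delta> (\<lambda>k. (T ^^ k) x)"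
  by (simp add: pseudo_orbit_def funpow_in)

lemma chain_orbit: "x \<in> X \<Longrightarrow> \<delta> > 0 \<Longrightarrow> chain X T \<delta> m (\<lambda>k. (T ^^ k) x)"
  by (simp add: pseudo_orbit_orbit pseudo_orbit_imp_chain)

lemma shadowed:
  assumes "shadowing X T" "e > 0"
  obtains \<delta> where "\<delta> > 0"
    "\<And>x. pseudo_orbit X T \<delta> x \<Longrightarrow> \<exists>z\<in>X. \<forall>n. dist ((T ^^ n) z) (x n) < e"
  using assms unfolding shadowing_def by blast

text \<open>
Transitivity gives a true orbit segment from near \<open>T x\<close> to near \<open>y\<close>. Replacing its two ends by
\<open>x\<close> and \<open>y\<close> costs one small jump at each end.
\<close>

lemma chain_between:
  assumes "topologically_transitive X T" "\<delta> > 0" "x \<in> X" "y \<in> X"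
  shows "\<exists>m f. m \<ge> 1 \<and> chain X T \<delta> m f \<and> f 0 = x \<and> f m = y"
proof -
  let ?U = "X \<inter> ball (T x) \<delta>" and ?V = "X \<inter> ball y \<delta>"
  have "T x \<in> ?U" "y \<in> ?V" using assms invariant by auto
  moreover have "openin (top_of_set X) ?U" "openin (top_of_set X) ?V"
    by (auto intro: openin_open_Int)
  ultimately obtain n where n: "n \<ge> 1" "(T ^^ n) ` ?U \<inter> ?V \<noteq> {}"
    using assms(1) unfolding topologically_transitive_def by (metis empty_iff)
  then obtain u where u: "u \<in> X" "dist (T x) u < \<delta>" "dist y ((T ^^ n) u) < \<delta>"
    by auto
  define f where "f i = (if i = 0 then x else if i = n + 1 then y else (T ^^ (i - 1)) u)" for i
  have "dist (f (Suc i)) (T (f i)) < \<delta>" if i: "i < n + 1" for i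
  proof -
    consider "i = 0" | "i = n" "i \<noteq> 0" | "i < n" "i \<noteq> 0"
      using i by (cases "i = 0"; cases "i = n") auto
    then show ?thesis
    proof cases
      case 1
      then show ?thesis using u n by (simp add: f_def dist_commute)
    next
      case 2
      then have "T (f i) = (T ^^ n) u" by (cases n) (auto simp: f_def)
      then show ?thesis using u(3) 2 by (simp add: f_def)
    next
      case 3
      then obtain j where "i = Suc j" by (cases i) auto
      then show ?thesis using assms(2) 3 by (simp add: f_def)
    qed
  qed
  moreover have "f i \<in> X" for i
    using assms u funpow_in by (simp add: f_def)
  ultimately have "chain X T \<delta> (n + 1) f" by (simp add: chain_def)
  moreover have "f 0 = x" "f (n + 1) = y" by (simp_all add: f_def)
  ultimately show ?thesis by (metis le_add2)
qed

end

section \<open>Chains that end at a periodic point in phase\<close>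

context dyn_system
begin

text \<open>
Chains without steps are excluded, because they do not survive a change of the starting point.
\<close>

definition return_residue :: "'a \<Rightarrow> nat \<Rightarrow> 'a \<Rightarrow> nat \<Rightarrow> bool" where
  "return_residue p P x r \<longleftrightarrow>
     (\<forall>\<delta>>0. \<exists>m f. m \<ge> 1 \<and> chain X T \<delta> m f \<and> f 0 = x \<and> f m = p \<and> m mod P = r)"

text \<open>
Only the first step of a chain sees its starting point, so nearby points admit chains of the
same length to the same end.
\<close>

lemma chain_perturb_start:
  assumes "chain X T \<delta> m f" "m \<ge> 1" "x \<in> X" "dist (T (f 0)) (T x) < \<delta>"
  shows "chain X T (2 * \<delta>) m (f(0 := x))"
proof -
  have pos: "\<delta> > 0" using assms(4) zero_le_dist[of "T (f 0)" "T x"] by linarith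
  have "dist ((f(0 := x)) (Suc i)) (T ((f(0 := x)) i)) < 2 * \<delta>" if i: "i < m" for i
  proof (cases i)
    case 0
    have "dist (f 1) (T (f 0)) < \<delta>" using assms(1,2) by (auto simp: chain_def)
    with assms(4) dist_triangle[of "f 1" "T x" "T (f 0)"] show ?thesis using 0 by simp
  next
    case (Suc j)
    then have "dist (f (Suc i)) (T (f i)) < \<delta>" using assms(1) i by (auto simp: chain_def)
    then show ?thesis using pos Suc by simp
  qed
  then show ?thesis using assms by (auto simp: chain_def)
qed

lemma return_residue_upper_semicontinuous:
  assumes "x \<in> X" "\<not> return_residue p P x r"
  shows "\<exists>e>0. \<forall>y\<in>X. dist x y < e \<longrightarrow> \<not> return_residue p P y r"
proof -
  obtain \<delta> where \<delta>: "\<delta> > 0"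
    "\<And>m f. m \<ge> 1 \<Longrightarrow> chain X T \<delta> m f \<Longrightarrow> f 0 = x \<Longrightarrow> f m = p \<Longrightarrow> m mod P \<noteq> r"
    using assms(2) unfolding return_residue_def by blast
  obtain e where e: "e > 0" "\<And>y. y \<in> X \<Longrightarrow> dist y x < e \<Longrightarrow> dist (T y) (T x) < \<delta> / 2"
    using cont assms(1) \<delta>(1) unfolding continuous_on_iff by (metis half_gt_zero)
  have "\<not> return_residue p P y r" if y: "y \<in> X" "dist x y < e" for y
  proof
    assume "return_residue p P y r"
    then obtain m f where f: "m \<ge> 1" "chain X T (\<delta>/2) m f" "f 0 = y" "f m = p" "m mod P = r"
      using \<delta>(1) unfolding return_residue_def by (metis half_gt_zero)
    have "chain X T (2 * (\<delta>/2)) m (f(0 := x))"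
      using f e(2)[OF y(1)] y(2) assms(1) by (intro chain_perturb_start) (auto simp: dist_commute)
    then show False using \<delta>(2)[of m "f(0 := x)"] f by auto
  qed
  then show ?thesis using e(1) by blast
qed

text \<open>
If each of the finitely many residues failed at some scale, no chain at the smallest of these
scales could have any residue at all.
\<close>

lemma return_residue_exists:
  assumes "topologically_transitive X T" "x \<in> X" "p \<in> X" "P > 0"
  shows "\<exists>r<P. return_residue p P x r"
proof (rule ccontr)
  assume "\<not> ?thesis"
  then have "\<forall>r\<in>{..<P}. \<exists>\<delta>>0. \<forall>m f. m \<ge> 1 \<longrightarrow> chain X T \<delta> m f \<longrightarrow> f 0 = x \<longrightarrow> f m = p \<longrightarrow> m mod P \<noteq> r"
    unfolding return_residue_def by auto blast
  then obtain D where D: "\<And>r. r < P \<Longrightarrow> D r > 0"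
    "\<And>r m f. r < P \<Longrightarrow> m \<ge> 1 \<Longrightarrow> chain X T (D r) m f \<Longrightarrow> f 0 = x \<Longrightarrow> f m = p \<Longrightarrow> m mod P \<noteq> r"
    by (metis lessThan_iff)
  define \<delta> where "\<delta> = Min (D ` {..<P})"
  have "\<delta> > 0" unfolding \<delta>_def using D(1) assms(4) by (subst Min_gr_iff) auto
  then obtain m f where f: "m \<ge> 1" "chain X T \<delta> m f" "f 0 = x" "f m = p"
    using chain_between[OF assms(1) _ assms(2,3)] by blast
  have lt: "m mod P < P" using assms(4) by simp
  then have "\<delta> \<le> D (m mod P)" unfolding \<delta>_def by (intro Min_le) auto
  then have "chain X T (D (m mod P)) m f" using f(2) by (force simp: chain_def)
  then show False using D(2)[OF lt f(1)] f by blast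
qed

text \<open>
\<open>D\<close> is an open set from whose points \<open>p\<close> can be reached in phase, that is, at a multiple of the
period.
\<close>

definition anchored :: "'a set \<Rightarrow> 'a \<Rightarrow> nat \<Rightarrow> bool" where
  "anchored D p P \<longleftrightarrow> P > 0 \<and> p \<in> X \<and> (T ^^ P) p = p \<and> D \<noteq> {} \<and> openin (top_of_set X) D \<and>
     (\<forall>x\<in>D. \<forall>\<delta>>0. \<exists>m f. P dvd m \<and> chain X T \<delta> m f \<and> f 0 = x \<and> f m = p)"

lemma anchored_fixed_point:
  assumes "topologically_transitive X T" "p \<in> fixed_points X T"
  shows "anchored X p 1"
proof -
  have p: "p \<in> X" "T p = p" using assms(2) by (auto simp: fixed_points_def)
  have "\<exists>m f. 1 dvd m \<and> chain X T \<delta> m f \<and> f 0 = x \<and> f m = p" if "x \<in> X" "\<delta> > 0" for x \<delta>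
    using chain_between[OF assms(1) that(2,1) p(1)] by auto
  then show ?thesis using p nonempty by (simp add: anchored_def)
qed

text \<open>
A category argument in miniature: the set \<open>R x\<close> of residues attained at every scale can only
shrink near \<open>x\<close>, so it is constant near a point where it has the least cardinality. A residue
\<open>r\<close> in it is then common to all points of an open set, and running \<open>P - r\<close> steps further along
the periodic orbit makes the length a multiple of \<open>P\<close>.
\<close>

lemma anchored_periodic_point:
  assumes "topologically_transitive X T" "p \<in> X" "P > 0" "(T ^^ P) p = p"
  shows "\<exists>D q. anchored D q P \<and> forward_orbit T q = forward_orbit T p"
proof -
  define R where "R x = {r. r < P \<and> return_residue p P x r}" for x
  have finR: "finite (R x)" for x by (simp add: R_def)
  obtain x where x: "x \<in> X" "\<And>y. y \<in> X \<Longrightarrow> card (R x) \<le> card (R y)"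
    using nonempty ex_has_least_nat[of "\<lambda>x. x \<in> X" _ "\<lambda>x. card (R x)"] by auto
  have "\<forall>r\<in>{..<P} - R x. \<exists>e>0. \<forall>y\<in>X. dist x y < e \<longrightarrow> r \<notin> R y"
    using return_residue_upper_semicontinuous[OF x(1)] unfolding R_def by auto
  then obtain e where e: "\<And>r. r \<in> {..<P} - R x \<Longrightarrow> e r > 0 \<and> (\<forall>y\<in>X. dist x y < e r \<longrightarrow> r \<notin> R y)"
    by metis
  define \<epsilon> where "\<epsilon> = Min (insert 1 (e ` ({..<P} - R x)))"
  have \<epsilon>: "\<epsilon> > 0" unfolding \<epsilon>_def using e by (subst Min_gr_iff) auto
  have sub: "R y = R x" if y: "y \<in> X" "dist x y < \<epsilon>" for y
  proof -
    have "R y \<subseteq> R x"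
    proof
      fix r assume r: "r \<in> R y"
      show "r \<in> R x"
      proof (rule ccontr)
        assume "r \<notin> R x"
        then have r': "r \<in> {..<P} - R x" using r by (auto simp: R_def)
        then have "\<epsilon> \<le> e r" unfolding \<epsilon>_def by (intro Min_le) auto
        then show False using e[OF r'] y r by force
      qed
    qed
    then show ?thesis using x(2)[OF y(1)] finR card_seteq by blast
  qed
  obtain r where r: "r < P" "r \<in> R x"
    using return_residue_exists[OF assms(1) x(1) assms(2,3)] by (auto simp: R_def)
  \<comment> \<open>the number of further steps that completes the residue \<open>r\<close> to the period\<close>
  define s where "s = P - r"
  define q where "q = (T ^^ s) p"
  define D where "D = X \<inter> ball x \<epsilon>"
  have perq: "(T ^^ r) q = p"
    using assms(4) r by (simp add: q_def s_def funpow_apply_add)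
  have "\<exists>m f. P dvd m \<and> chain X T \<delta> m f \<and> f 0 = y \<and> f m = q" if y: "y \<in> D" and "\<delta> > 0" for y \<delta>
  proof -
    have "r \<in> R y" using sub[of y] y r by (simp add: D_def)
    then obtain m f where f: "chain X T \<delta> m f" "f 0 = y" "f m = p" "m mod P = r"
      using \<open>\<delta> > 0\<close> unfolding R_def return_residue_def by blast
    let ?g = "splice_at m f (\<lambda>k. (T ^^ k) p)"
    have "chain X T \<delta> (m + s) ?g"
      using f assms(2) \<open>\<delta> > 0\<close> by (intro chain_splice chain_orbit) auto
    moreover have "?g 0 = y" using f by (simp add: splice_at_0)
    moreover have "?g (m + s) = q" by (simp add: q_def)
    moreover have "P dvd m + s"
    proof -
      have "m + s = m div P * P + P"
        using f(4) r(1) div_mult_mod_eq[of m P] by (simp add: s_def)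
      then show ?thesis by simp
    qed
    ultimately show ?thesis by blast
  qed
  moreover have "(T ^^ P) q = q"
  proof -
    have "(T ^^ P) q = (T ^^ s) ((T ^^ P) p)" by (simp add: q_def funpow_apply_add add.commute)
    then show ?thesis using assms(4) by (simp add: q_def)
  qed
  moreover have "x \<in> D" "openin (top_of_set X) D" "q \<in> X"
    using x \<epsilon> assms(2) by (auto simp: D_def q_def funpow_in intro: openin_open_Int)
  ultimately have "anchored D q P" unfolding anchored_def using assms(3) by auto
  moreover have "forward_orbit T q = forward_orbit T p"
    unfolding forward_orbit_def
  proof (intro equalityI subsetI; elim rangeE)
    fix y k assume "y = (T ^^ k) q"
    then show "y \<in> range (\<lambda>n. (T ^^ n) p)" by (auto simp: q_def funpow_apply_add)
  next
    fix y k assume "y = (T ^^ k) p"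
    then have "y = (T ^^ (k + r)) q" by (simp add: perq flip: funpow_apply_add)
    then show "y \<in> range (\<lambda>n. (T ^^ n) q)" by blast
  qed
  ultimately show ?thesis by blast
qed

end

section \<open>Orbits that stay apart from their own shifts\<close>

lemma dist_iterate_le:
  fixes w :: "nat \<Rightarrow> 'a::metric_space"
  assumes "\<And>i. i < n \<Longrightarrow> dist (w (a + i * c)) (w (a + Suc i * c)) \<le> e"
  shows "dist (w a) (w (a + n * c)) \<le> n * e"
  using assms
proof (induction n)
  case (Suc n)
  have "dist (w a) (w (a + Suc n * c)) \<le> dist (w a) (w (a + n * c)) + dist (w (a + n * c)) (w (a + Suc n * c))"
    by (rule dist_triangle)
  also have "\<dots> \<le> n * e + e" using Suc by (intro add_mono) auto
  finally show ?case by (simp add: algebra_simps)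
qed simp

context dyn_system
begin

text \<open>
The round trip whose periodic repetition is shadowed below: first a waiting time of \<open>N\<close> steps on
the orbit of \<open>p\<close>, later a visit to \<open>q\<close>.
\<close>

lemma closed_chain:
  assumes "topologically_transitive X T" "p \<in> X" "q \<in> X" "\<delta> > 0"
  shows "\<exists>L e f. chain X T \<delta> L f \<and> N \<le> e \<and> e \<le> L \<and> L > 0 \<and> f 0 = p \<and> f L = p \<and> f e = q \<and>
           (\<forall>i<N. f i = (T ^^ i) p)"
proof -
  obtain m1 f1 where f1: "m1 \<ge> 1" "chain X T \<delta> m1 f1" "f1 0 = (T ^^ N) p" "f1 m1 = q"
    using chain_between[OF assms(1,4) funpow_in[OF assms(2)] assms(3)] by blast
  obtain m2 f2 where f2: "m2 \<ge> 1" "chain X T \<delta> m2 f2" "f2 0 = q" "f2 m2 = p"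
    using chain_between[OF assms(1,4,3,2)] by blast
  let ?g = "splice_at m1 f1 f2"
  let ?f = "splice_at N (\<lambda>k. (T ^^ k) p) ?g"
  have "chain X T \<delta> (m1 + m2) ?g" "?g 0 = (T ^^ N) p"
    using f1 f2 by (auto intro: chain_splice simp: splice_at_0)
  then have "chain X T \<delta> (N + (m1 + m2)) ?f" "?f 0 = p"
    using assms by (auto intro!: chain_splice chain_orbit simp: splice_at_0)
  moreover have "?f (N + (m1 + m2)) = p" "?f (N + m1) = q"
    using f2 splice_at_add[of m1 f1 f2 0] by simp_all
  moreover have "\<forall>i<N. ?f i = (T ^^ i) p" by (simp add: splice_at_def)
  ultimately show ?thesis
    using f1(1) by (intro exI[of _ "N + (m1 + m2)"] exI[of _ "N + m1"] exI[of _ ?f]) auto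
qed

text \<open>
Let \<open>z\<close> shadow the periodic repetition of such a round trip of length \<open>L\<close>. Suppose that at some
time the orbit of \<open>z\<close> is very close to its shift by \<open>c \<le> N\<close>. By equicontinuity the two stay
close for time \<open>2 * L\<close>, which covers a complete round. Going back from the visit to \<open>q\<close> at time
\<open>e\<close> in steps of \<open>c\<close> leads to the time \<open>e mod c < N\<close>, at which \<open>z\<close> is near the orbit of \<open>p\<close>. At
most \<open>L\<close> steps are taken, so the errors add up to at most \<open>\<epsilon>\<close>, and \<open>q\<close> would be within
\<open>3 * \<epsilon>\<close> of the orbit of \<open>p\<close>.
\<close>

lemma orbit_with_separated_shifts:
  assumes trans: "topologically_transitive X T" and shad: "shadowing X T"
    and p: "p \<in> X" "P > 0" "(T ^^ P) p = p" and q: "q \<in> X" "q \<notin> forward_orbit T p"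
  shows "\<exists>z\<in>X. \<exists>d>0. \<forall>k c. 1 \<le> c \<longrightarrow> c \<le> N \<longrightarrow> dist ((T ^^ k) z) ((T ^^ (k + c)) z) > d"
proof -
  have "finite (forward_orbit T p)" by (rule finite_forward_orbit[OF p(3,2)])
  then obtain e0 where "e0 > 0" "\<forall>x\<in>forward_orbit T p. x \<noteq> q \<longrightarrow> e0 \<le> dist q x"
    using finite_set_avoid[of _ q] by blast
  then have e0: "e0 > 0" "\<And>k. dist q ((T ^^ k) p) \<ge> e0" using q(2) by (auto simp: forward_orbit_def)
  define \<epsilon> where "\<epsilon> = e0 / 4"
  have \<epsilon>: "\<epsilon> > 0" using e0 by (simp add: \<epsilon>_def)
  obtain \<delta> where \<delta>: "\<delta> > 0"
    "\<And>x. pseudo_orbit X T \<delta> x \<Longrightarrow> \<exists>z\<in>X. \<forall>n. dist ((T ^^ n) z) (x n) < \<epsilon>"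
    using shadowed[OF shad \<epsilon>] by blast
  obtain L e f where f: "chain X T \<delta> L f" "N \<le> e" "e \<le> L" "L > 0" "f 0 = p" "f L = p" "f e = q"
    "\<And>i. i < N \<Longrightarrow> f i = (T ^^ i) p"
    using closed_chain[OF trans p(1) q(1) \<delta>(1)] by blast
  have "p \<in> forward_orbit T p" unfolding forward_orbit_def by (metis funpow_0 rangeI)
  then have "e \<noteq> L" using f(6,7) q(2) by metis
  then have eL: "e < L" using f(3) by simp
  obtain z where z: "z \<in> X" "\<And>n. dist ((T ^^ n) z) (f (n mod L)) < \<epsilon>"
    using \<delta>(2)[OF chain_loop_pseudo_orbit[OF f(1)]] f(4,5,6) by auto
  have pos: "\<epsilon> / (L + 1) > 0" using \<epsilon> by simp
  obtain d where d: "d > 0" "\<And>u v k. u \<in> X \<Longrightarrow> v \<in> X \<Longrightarrow> dist u v < d \<Longrightarrow> k \<le> 2 * L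
      \<Longrightarrow> dist ((T ^^ k) u) ((T ^^ k) v) < \<epsilon> / (L + 1)"
    using equicontinuous_funpow[OF pos, of "2 * L"] by blast
  have far: "dist ((T ^^ k) z) ((T ^^ (k + c)) z) \<ge> d" if c: "1 \<le> c" "c \<le> N" for k c
  proof (rule ccontr)
    assume "\<not> ?thesis"
    then have small: "dist ((T ^^ k) z) ((T ^^ (k + c)) z) < d" by simp
    \<comment> \<open>the beginning of the first complete round after time \<open>k\<close>\<close>
    define t where "t = L * (k div L + 1)"
    have "t = L * (k div L) + L" by (simp add: t_def)
    moreover have "L * (k div L) + k mod L = k" "k mod L < L" using f(4) by simp_all
    ultimately have t: "k \<le> t" "t \<le> k + L" by linarith+
    have step: "dist ((T ^^ i) z) ((T ^^ (i + c)) z) \<le> \<epsilon> / (L + 1)" if "t \<le> i" "i \<le> t + L" for i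
    proof -
      have "dist ((T ^^ (i - k)) ((T ^^ k) z)) ((T ^^ (i - k)) ((T ^^ (k + c)) z)) < \<epsilon> / (L + 1)"
        using small that t z(1) by (intro d(2)) (auto simp: funpow_in)
      moreover have "i - k + k = i" "i - k + (k + c) = i + c" using that t by auto
      ultimately show ?thesis by (simp add: funpow_apply_add)
    qed
    define b where "b = e mod c"
    define n where "n = e div c"
    have bn: "b + n * c = e" "b < c" using c by (auto simp: b_def n_def)
    have t_mod: "(t + i) mod L = i" if "i < L" for i
    proof -
      have "t + i = i + (k div L + 1) * L" by (simp add: t_def algebra_simps)
      then have "(t + i) mod L = i mod L" by (simp only: mod_mult_self3 mod_mult_self1)
      then show ?thesis using that by simp
    qed
    have bN: "b < N" using bn(2) c(2) by linarith
    have bL: "b < L" using bn(1) eL by linarith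
    have nle: "n \<le> L"
      using f(3) div_le_dividend[of e c] unfolding n_def by linarith
    have tr: "dist ((T ^^ (t + b)) z) ((T ^^ (t + b + n * c)) z) \<le> n * (\<epsilon> / (L + 1))"
    proof (rule dist_iterate_le[where w="\<lambda>i. (T ^^ i) z"])
      fix i assume "i < n"
      then have "i * c \<le> n * c" by simp
      then have "t + b + i * c \<le> t + L" using bn f(3) by linarith
      then show "dist ((T ^^ (t + b + i * c)) z) ((T ^^ (t + b + Suc i * c)) z) \<le> \<epsilon> / (L + 1)"
        using step[of "t + b + i * c"] by (simp add: algebra_simps)
    qed
    also have "\<dots> \<le> L * (\<epsilon> / (L + 1))" using nle pos by (intro mult_right_mono) auto
    also have "\<dots> \<le> \<epsilon>" using \<epsilon> by (simp add: field_simps)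
    finally have 1: "dist ((T ^^ (t + b)) z) ((T ^^ (t + e)) z) \<le> \<epsilon>"
      using bn by (simp add: add.assoc)
    have 2: "dist ((T ^^ (t + b)) z) ((T ^^ b) p) < \<epsilon>"
      using z(2)[of "t + b"] unfolding t_mod[OF bL] f(8)[OF bN] .
    have 3: "dist ((T ^^ (t + e)) z) q < \<epsilon>" using z(2)[of "t + e"] unfolding t_mod[OF eL] f(7) .
    have "dist q ((T ^^ b) p) \<le> dist q ((T ^^ (t + e)) z) + dist ((T ^^ (t + e)) z) ((T ^^ (t + b)) z)
        + dist ((T ^^ (t + b)) z) ((T ^^ b) p)"
      using dist_triangle[of q "(T ^^ b) p" "(T ^^ (t + b)) z"]
        dist_triangle[of q "(T ^^ (t + b)) z" "(T ^^ (t + e)) z"] by linarith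
    also have "\<dots> < 3 * \<epsilon>" using 1 2 3 by (simp add: dist_commute)
    also have "\<dots> < e0" using \<epsilon> by (simp add: \<epsilon>_def)
    finally show False using e0(2)[of b] by simp
  qed
  have "dist ((T ^^ k) z) ((T ^^ (k + c)) z) > d / 2" if "1 \<le> c" "c \<le> N" for k c
    using far[OF that, of k] d(1) by linarith
  moreover have "d / 2 > 0" using d(1) by simp
  ultimately show ?thesis using z(1) by blast
qed

end

section \<open>Upper density one\<close>

text \<open>
A finite witness for upper density one: some initial segment longer than \<open>s\<close> has density at
least \<open>1 - 1/(s+1)\<close> in it. Unlike the density itself, this depends on finitely many times only.
\<close>

definition often :: "nat \<Rightarrow> nat set \<Rightarrow> bool" where
  "often s A \<longleftrightarrow> (\<exists>m>s. real (card (A \<inter> {..<m})) \<ge> (1 - 1 / (real s + 1)) * real m)"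

lemma often_mono: "often s A \<Longrightarrow> A \<subseteq> B \<Longrightarrow> often s B"
  unfolding often_def
proof (elim exE conjE)
  fix m assume a: "A \<subseteq> B" "m > s" "(1 - 1 / (real s + 1)) * real m \<le> real (card (A \<inter> {..<m}))"
  have "card (A \<inter> {..<m}) \<le> card (B \<inter> {..<m})" using a(1) by (intro card_mono) auto
  then show "\<exists>m>s. (1 - 1 / (real s + 1)) * real m \<le> real (card (B \<inter> {..<m}))"
    using a(2,3) by (intro exI[of _ m]) linarith
qed

lemma often_nonempty: "often s A \<Longrightarrow> s > 0 \<Longrightarrow> A \<noteq> {}"
  unfolding often_def by (auto simp: mult_le_0_iff field_simps)

text \<open>
The segment that ends at \<open>(s+1) * (M+1)\<close> is so long that the first \<open>M\<close> times do not matter.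
\<close>

lemma often_window:
  assumes "\<And>k. M \<le> k \<Longrightarrow> k < Suc s * Suc M \<Longrightarrow> k \<in> A"
  shows "often s A"
proof -
  define m where "m = Suc s * Suc M"
  have "M \<le> m" "m > s" by (simp_all add: m_def)
  have "card {M..<m} \<le> card (A \<inter> {..<m})" using assms by (intro card_mono) (auto simp: m_def)
  then have "real m - real M \<le> real (card (A \<inter> {..<m}))" using \<open>M \<le> m\<close> by simp
  moreover have "(1 - 1 / (real s + 1)) * real m = real m - (real M + 1)"
    by (simp add: m_def field_simps)
  ultimately have "(1 - 1 / (real s + 1)) * real m \<le> real (card (A \<inter> {..<m}))" by linarith
  then show ?thesis unfolding often_def using \<open>m > s\<close> by blast
qed

lemma upper_density_le_1: "upper_density A \<le> 1"
  unfolding upper_density_def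
proof (intro Limsup_bounded always_eventually allI)
  fix m
  have "card (A \<inter> {..<m}) \<le> card {..<m}" by (intro card_mono) auto
  then show "ereal (real (card (A \<inter> {..<m})) / real m) \<le> 1"
    by (cases "m = 0") (auto simp: field_simps)
qed

lemma upper_density_eq_1:
  assumes "\<And>s. s \<ge> s0 \<Longrightarrow> often s A"
  shows "upper_density A = 1"
proof (rule ccontr)
  assume "upper_density A \<noteq> 1"
  then have "upper_density A < 1" using upper_density_le_1[of A] by simp
  then obtain c where c: "upper_density A < ereal c" "ereal c < 1"
    using ereal_dense2 by blast
  then have "c < 1" by simp
  have "eventually (\<lambda>m. ereal (real (card (A \<inter> {..<m})) / real m) < ereal c) sequentially"
    using c(1) unfolding upper_density_def by (rule Limsup_lessD)
  then obtain m0 where m0: "\<And>m. m \<ge> m0 \<Longrightarrow> real (card (A \<inter> {..<m})) / real m < c"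
    unfolding eventually_sequentially by auto
  obtain s1 :: nat where s1: "inverse (real (Suc s1)) < 1 - c"
    using reals_Archimedean[of "1 - c"] \<open>c < 1\<close> by auto
  define s where "s = s0 + m0 + s1"
  obtain m where m: "m > s" "real (card (A \<inter> {..<m})) \<ge> (1 - 1 / (real s + 1)) * real m"
    using assms[of s] unfolding often_def s_def by auto
  have "1 / (real s + 1) \<le> 1 / (real s1 + 1)" by (intro divide_left_mono) (auto simp: s_def)
  then have "c \<le> 1 - 1 / (real s + 1)" using s1 by (simp add: inverse_eq_divide add.commute)
  also have "\<dots> \<le> real (card (A \<inter> {..<m})) / real m" using m by (simp add: le_divide_eq)
  finally show False using m0[of m] m(1) by (simp add: s_def)
qed

section \<open>Generic properties of tuples\<close>

text \<open>
The interior of \<open>Q\<close>, as a set of families indexed by \<open>I\<close>, is dense in the families of points of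
\<open>D\<close>, with respect to the uniform distance. The interior is taken in \<open>X\<close>, because the limit
points constructed later are only known to lie in the closure of \<open>D\<close>.
\<close>

definition generically ::
    "'a::metric_space set \<Rightarrow> 'a set \<Rightarrow> 'i set \<Rightarrow> (('i \<Rightarrow> 'a) \<Rightarrow> bool) \<Rightarrow> bool" where
  "generically X D I Q \<longleftrightarrow>
     (\<forall>u r. (\<forall>i\<in>I. u i \<in> D) \<and> r > 0 \<longrightarrow>
       (\<exists>v r'. r' > 0 \<and> (\<forall>i\<in>I. v i \<in> D \<and> dist (v i) (u i) < r) \<and>
         (\<forall>y. (\<forall>i\<in>I. y i \<in> X \<and> dist (y i) (v i) < r') \<longrightarrow> Q y)))"

lemma genericallyE:
  assumes "generically X D I Q" "\<forall>i\<in>I. u i \<in> D" "r > 0"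
  obtains v r' where "r' > 0" "\<forall>i\<in>I. v i \<in> D \<and> dist (v i) (u i) < r"
    "\<And>y. \<forall>i\<in>I. y i \<in> X \<and> dist (y i) (v i) < r' \<Longrightarrow> Q y"
proof -
  have "(\<forall>i\<in>I. u i \<in> D) \<and> r > 0" using assms(2,3) by simp
  from assms(1)[unfolded generically_def, THEN spec, THEN spec, THEN mp, OF this]
  show ?thesis
  proof (elim exE conjE)
    fix v r' assume "r' > 0" "\<forall>i\<in>I. v i \<in> D \<and> dist (v i) (u i) < r"
      "\<forall>y. (\<forall>i\<in>I. y i \<in> X \<and> dist (y i) (v i) < r') \<longrightarrow> Q y"
    then show ?thesis by (intro that[of r' v]) auto
  qed
qed

lemma generically_conj:
  assumes "generically X D I Q" "generically X D I R"
  shows "generically X D I (\<lambda>y. Q y \<and> R y)"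
  unfolding generically_def
proof (intro allI impI; elim conjE)
  fix u and r :: real assume u: "\<forall>i\<in>I. u i \<in> D" and r: "r > 0"
  obtain v a where v: "a > 0" "\<forall>i\<in>I. v i \<in> D \<and> dist (v i) (u i) < r / 2"
    "\<And>y. \<forall>i\<in>I. y i \<in> X \<and> dist (y i) (v i) < a \<Longrightarrow> Q y"
    by (rule genericallyE[OF assms(1) u half_gt_zero[OF r]]) (rule that; assumption)
  define c where "c = min (a / 2) (r / 2)"
  have c: "c > 0" using v r by (simp add: c_def)
  have "\<forall>i\<in>I. v i \<in> D" using v(2) by blast
  then obtain w b where w: "b > 0" "\<forall>i\<in>I. w i \<in> D \<and> dist (w i) (v i) < c"
    "\<And>y. \<forall>i\<in>I. y i \<in> X \<and> dist (y i) (w i) < b \<Longrightarrow> R y"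
    by (rule genericallyE[OF assms(2) _ c]) (rule that; assumption)
  have 1: "dist (w i) (u i) < r" if "i \<in> I" for i
    using v(2) w(2) that dist_triangle_half_r[of "v i" "w i" r "u i"]
    unfolding c_def by (simp add: dist_commute)
  have 2: "Q y" "R y" if y: "\<forall>i\<in>I. y i \<in> X \<and> dist (y i) (w i) < min b (a / 2)" for y
  proof -
    show "R y" using w(3) y by auto
    have "dist (y i) (v i) < a" if "i \<in> I" for i
      using w(2) y that dist_triangle_half_r[of "w i" "y i" a "v i"]
      unfolding c_def by (simp add: dist_commute)
    then show "Q y" using v(3) y by blast
  qed
  show "\<exists>v r'. r' > 0 \<and> (\<forall>i\<in>I. v i \<in> D \<and> dist (v i) (u i) < r) \<and>
         (\<forall>y. (\<forall>i\<in>I. y i \<in> X \<and> dist (y i) (v i) < r') \<longrightarrow> Q y \<and> R y)"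
  proof (intro exI conjI allI impI ballI)
    show "min b (a / 2) > 0" using v(1) w(1) by simp
  qed (use 1 2 w(2) in auto)
qed

lemma generically_mono:
  assumes "generically X D I Q" "\<And>y. Q y \<Longrightarrow> R y"
  shows "generically X D I R"
  unfolding generically_def
proof (intro allI impI; elim conjE)
  fix u and r :: real assume u: "\<forall>i\<in>I. u i \<in> D" and r: "r > 0"
  obtain v a where v: "a > 0" "\<forall>i\<in>I. v i \<in> D \<and> dist (v i) (u i) < r"
    "\<And>y. \<forall>i\<in>I. y i \<in> X \<and> dist (y i) (v i) < a \<Longrightarrow> Q y"
    by (rule genericallyE[OF assms(1) u r]) (rule that; assumption)
  show "\<exists>v r'. r' > 0 \<and> (\<forall>i\<in>I. v i \<in> D \<and> dist (v i) (u i) < r) \<and>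
         (\<forall>y. (\<forall>i\<in>I. y i \<in> X \<and> dist (y i) (v i) < r') \<longrightarrow> R y)"
  proof (intro exI conjI allI impI)
    show "R y" if "\<forall>i\<in>I. y i \<in> X \<and> dist (y i) (v i) < a" for y
      using assms(2)[OF v(3)[OF that]] .
  qed (use v in auto)
qed

lemma generically_True: "generically X D I (\<lambda>y. True)"
  unfolding generically_def by (auto intro!: exI[of _ "1::real"])

lemma generically_ball:
  assumes "finite A" "\<And>a. a \<in> A \<Longrightarrow> generically X D I (Q a)"
  shows "generically X D I (\<lambda>y. \<forall>a\<in>A. Q a y)"
  using assms
proof (induction A)
  case (insert a A)
  then have "generically X D I (\<lambda>y. Q a y \<and> (\<forall>a\<in>A. Q a y))"
    by (intro generically_conj) auto
  then show ?case by simp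
qed (simp add: generically_True)

text \<open>
A condition on \<open>J\<close>-tuples becomes a condition on a larger family through an injection \<open>t\<close>. The
tuple is bound by its values on \<open>J\<close> because functions may be arbitrary outside \<open>J\<close>.
\<close>

lemma generically_pullback:
  assumes "generically X D J Q" "inj_on t J" "t ` J \<subseteq> I"
  shows "generically X D I (\<lambda>y. \<forall>x. (\<forall>j\<in>J. x j = y (t j)) \<longrightarrow> Q x)"
  unfolding generically_def
proof (intro allI impI; elim conjE)
  fix u and r :: real assume u: "\<forall>i\<in>I. u i \<in> D" and r: "r > 0"
  have "\<forall>j\<in>J. u (t j) \<in> D" using u assms(3) by auto
  then obtain v r' where v: "r' > 0" "\<forall>j\<in>J. v j \<in> D \<and> dist (v j) (u (t j)) < r"
    "\<And>y. \<forall>j\<in>J. y j \<in> X \<and> dist (y j) (v j) < r' \<Longrightarrow> Q y"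
    by (rule genericallyE[OF assms(1) _ r]) (rule that; assumption)
  define w where "w i = (if i \<in> t ` J then v (the_inv_into J t i) else u i)" for i
  have wt: "w (t j) = v j" if "j \<in> J" for j
    using that assms(2) by (simp add: w_def the_inv_into_f_f)
  have 1: "w i \<in> D \<and> dist (w i) (u i) < r" if "i \<in> I" for i
  proof (cases "i \<in> t ` J")
    case True
    then show ?thesis using v(2) wt by auto
  qed (use u r that in \<open>simp add: w_def\<close>)
  have 2: "Q x" if y: "\<forall>i\<in>I. y i \<in> X \<and> dist (y i) (w i) < r'" and x: "\<forall>j\<in>J. x j = y (t j)" for x y
  proof (rule v(3), rule ballI)
    fix j assume j: "j \<in> J"
    then have "t j \<in> I" using assms(3) by blast
    then show "x j \<in> X \<and> dist (x j) (v j) < r'" using y x wt[OF j] j by auto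
  qed
  show "\<exists>v r'. r' > 0 \<and> (\<forall>i\<in>I. v i \<in> D \<and> dist (v i) (u i) < r) \<and>
         (\<forall>y. (\<forall>i\<in>I. y i \<in> X \<and> dist (y i) (v i) < r') \<longrightarrow> (\<forall>x. (\<forall>j\<in>J. x j = y (t j)) \<longrightarrow> Q x))"
  proof (intro exI conjI allI impI ballI)
    show "r' > 0" by (rule v(1))
  qed (use 1 2 in auto)
qed

section \<open>Closeness and separation are generic\<close>

context dyn_system
begin

lemma orbit_splice:
  assumes "x \<in> X" "\<delta> > 0" "pseudo_orbit X T \<delta> g" "(T ^^ m) x = g 0"
  shows "pseudo_orbit X T \<delta> (splice_at m (\<lambda>k. (T ^^ k) x) g)"
    and "splice_at m (\<lambda>k. (T ^^ k) x) g 0 = x"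
  using assms by (auto intro!: pseudo_orbit_splice chain_orbit simp: splice_at_0)

lemma anchored_chain:
  assumes "anchored D p P" "x \<in> D" "\<delta> > 0"
  shows "\<exists>m f. P dvd m \<and> chain X T \<delta> m f \<and> f 0 = x \<and> f m = p"
  using assms unfolding anchored_def by blast

text \<open>
Chains of different lengths are padded with copies of the orbit of \<open>p\<close>. The gaps are multiples
of \<open>P\<close>, so the padding returns to \<open>p\<close> exactly.
\<close>

lemma synchronised_pseudo_orbits:
  assumes anch: "anchored D p P" and I: "finite I" and \<delta>: "\<delta> > 0" and u: "\<And>i. i \<in> I \<Longrightarrow> u i \<in> D"
    and y: "\<And>i. i \<in> I \<Longrightarrow> pseudo_orbit X T \<delta> (y i) \<and> y i 0 = p"
  shows "\<exists>M w. \<forall>i\<in>I. pseudo_orbit X T \<delta> (w i) \<and> w i 0 = u i \<and> (\<forall>k. w i (M + k) = y i k)"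
proof -
  have p: "p \<in> X" "(T ^^ P) p = p" using anch by (auto simp: anchored_def)
  have "\<forall>i\<in>I. \<exists>m f. P dvd m \<and> chain X T \<delta> m f \<and> f 0 = u i \<and> f m = p"
    using anchored_chain[OF anch u \<delta>] by blast
  then obtain m f where f: "\<And>i. i \<in> I \<Longrightarrow> P dvd m i \<and> chain X T \<delta> (m i) (f i) \<and> f i 0 = u i \<and> f i (m i) = p"
    by metis
  define M where "M = sum m I"
  define w where "w i = splice_at (m i) (f i) (splice_at (M - m i) (\<lambda>k. (T ^^ k) p) (y i))" for i
  have "P dvd M" unfolding M_def using f by (intro dvd_sum) blast
  have "pseudo_orbit X T \<delta> (w i) \<and> w i 0 = u i \<and> (\<forall>k. w i (M + k) = y i k)" if i: "i \<in> I" for i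
  proof -
    let ?g = "splice_at (M - m i) (\<lambda>k. (T ^^ k) p) (y i)"
    have le: "m i \<le> M" unfolding M_def using I i by (intro member_le_sum) auto
    have "P dvd M - m i" using \<open>P dvd M\<close> f[OF i] by (simp add: dvd_diff_nat)
    then have "(T ^^ (M - m i)) p = p" by (rule funpow_mult_fixed[OF p(2)])
    then have eq: "(T ^^ (M - m i)) p = y i 0" using y[OF i] by simp
    have g: "pseudo_orbit X T \<delta> ?g" "?g 0 = p"
      using orbit_splice[OF p(1) \<delta> conjunct1[OF y[OF i]] eq] by blast+
    have "w i (M + k) = y i k" for k
    proof -
      have "M + k = m i + ((M - m i) + k)" using le by simp
      then show ?thesis unfolding w_def by (simp only: splice_at_add)
    qed
    moreover have "pseudo_orbit X T \<delta> (w i)"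
      unfolding w_def using pseudo_orbit_splice[OF _ g(1), of "m i" "f i"] f[OF i] g(2) by simp
    moreover have "w i 0 = u i"
      unfolding w_def using splice_at_0[of "f i" "m i" ?g] f[OF i] g(2) by simp
    ultimately show ?thesis by blast
  qed
  then show ?thesis by blast
qed

lemma uniform_radius_in_open:
  assumes "openin (top_of_set X) D" "finite I" "\<And>i. i \<in> I \<Longrightarrow> u i \<in> D"
  shows "\<exists>r>0. \<forall>i\<in>I. \<forall>x\<in>X. dist x (u i) < r \<longrightarrow> x \<in> D"
proof -
  have "\<forall>i\<in>I. \<exists>r>0. \<forall>x\<in>X. dist x (u i) < r \<longrightarrow> x \<in> D"
    using assms(1,3) unfolding openin_euclidean_subtopology_iff by blast
  then obtain r where r: "\<And>i. i \<in> I \<Longrightarrow> r i > 0 \<and> (\<forall>x\<in>X. dist x (u i) < r i \<longrightarrow> x \<in> D)" by metis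
  define r0 where "r0 = Min (insert 1 (r ` I))"
  have "r0 > 0" unfolding r0_def using assms(2) r by (subst Min_gr_iff) auto
  moreover have "r0 \<le> r i" if "i \<in> I" for i
    unfolding r0_def using assms(2) that by (intro Min_le) auto
  ultimately show ?thesis using r by (meson order_less_le_trans)
qed

text \<open>
The bridge from dynamics to genericity. The condition \<open>B\<close> concerns the positions at one time and
tolerates the error \<open>e\<close>. Suppose that there are pseudo-orbits from \<open>p\<close>, of any quality, along
which \<open>B\<close> holds eventually. Prefix them with synchronised chains from given points and shadow the
result: half of \<open>e\<close> pays for the shadowing, the other half for moving the starting points, which
is harmless over the finite time that \<open>often\<close> looks at.
\<close>

lemma generically_often_if_traced:
  fixes B :: "('i \<Rightarrow> 'a) \<Rightarrow> bool"
  assumes shad: "shadowing X T" and anch: "anchored D p P" and I: "finite I" and e: "e > 0"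
    and y: "\<And>\<delta>. \<delta> > 0 \<Longrightarrow> \<exists>y k0. (\<forall>i\<in>I. pseudo_orbit X T \<delta> (y i) \<and> y i 0 = p) \<and>
      (\<forall>k\<ge>k0. \<forall>a. (\<forall>i\<in>I. dist (a i) (y i k) < e) \<longrightarrow> B a)"
  shows "generically X D I (\<lambda>x. often s {k. B (\<lambda>i. (T ^^ k) (x i))})"
  unfolding generically_def
proof (intro allI impI; elim conjE)
  fix u and r :: real assume u: "\<forall>i\<in>I. u i \<in> D" and r: "r > 0"
  have D: "openin (top_of_set X) D" using anch by (simp add: anchored_def)
  obtain r2 where r2: "r2 > 0" "\<forall>i\<in>I. \<forall>x\<in>X. dist x (u i) < r2 \<longrightarrow> x \<in> D"
    using uniform_radius_in_open[OF D I] u by blast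
  \<comment> \<open>so small that the shadowing points lie in \<open>D\<close>, are close to \<open>u\<close>, and use half of the error\<close>
  define r1 where "r1 = min r2 (min r (e / 2))"
  have r1: "r1 > 0" "r1 \<le> r2" "r1 \<le> r" "r1 \<le> e / 2" using r2 r e by (auto simp: r1_def)
  obtain \<delta> where \<delta>: "\<delta> > 0"
    "\<And>x. pseudo_orbit X T \<delta> x \<Longrightarrow> \<exists>z\<in>X. \<forall>n. dist ((T ^^ n) z) (x n) < r1"
    using shadowed[OF shad r1(1)] by blast
  obtain y k0 where y: "\<forall>i\<in>I. pseudo_orbit X T \<delta> (y i) \<and> y i 0 = p"
    "\<And>k a. k \<ge> k0 \<Longrightarrow> \<forall>i\<in>I. dist (a i) (y i k) < e \<Longrightarrow> B a"
    using y[OF \<delta>(1)] by blast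
  obtain M w where w: "\<forall>i\<in>I. pseudo_orbit X T \<delta> (w i) \<and> w i 0 = u i \<and> (\<forall>k. w i (M + k) = y i k)"
    using synchronised_pseudo_orbits[OF anch I \<delta>(1), of u y] u y(1) by blast
  then have "\<forall>i\<in>I. \<exists>z\<in>X. \<forall>n. dist ((T ^^ n) z) (w i n) < r1" using \<delta>(2) by blast
  then obtain v where v: "\<And>i. i \<in> I \<Longrightarrow> v i \<in> X \<and> (\<forall>n. dist ((T ^^ n) (v i)) (w i n) < r1)" by metis
  have vu: "dist (v i) (u i) < r1" if "i \<in> I" for i
    using v[OF that] w that by (metis funpow_0)
  have vD: "v i \<in> D \<and> dist (v i) (u i) < r" if "i \<in> I" for i
  proof
    have "dist (v i) (u i) < r2" using vu[OF that] r1(2) by linarith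
    then show "v i \<in> D" using r2(2) v[OF that] that by blast
    show "dist (v i) (u i) < r" using vu[OF that] r1(3) by linarith
  qed
  \<comment> \<open>the horizon up to which \<open>often_window\<close> needs control\<close>
  define m where "m = Suc s * Suc (M + k0)"
  obtain r' where r': "r' > 0" "\<And>x y k. x \<in> X \<Longrightarrow> y \<in> X \<Longrightarrow> dist x y < r' \<Longrightarrow> k \<le> m
      \<Longrightarrow> dist ((T ^^ k) x) ((T ^^ k) y) < e / 2"
    using equicontinuous_funpow[of "e / 2" m] e by auto
  have "often s {k. B (\<lambda>i. (T ^^ k) (x i))}" if x: "\<forall>i\<in>I. x i \<in> X \<and> dist (x i) (v i) < r'" for x
  proof (rule often_window[of "M + k0"])
    fix k assume k: "M + k0 \<le> k" "k < Suc s * Suc (M + k0)"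
    have "dist ((T ^^ k) (x i)) (y i (k - M)) < e" if i: "i \<in> I" for i
    proof -
      have "w i k = y i (k - M)" using w i k(1) by (metis add_leD1 le_add_diff_inverse)
      then have "dist ((T ^^ k) (v i)) (y i (k - M)) < e / 2"
        using v[OF i] r1(4) by (metis order_less_le_trans)
      moreover have "dist ((T ^^ k) (x i)) ((T ^^ k) (v i)) < e / 2"
        using x i v[OF i] k(2) by (intro r'(2)) (auto simp: m_def)
      ultimately show ?thesis
        using dist_triangle[of "(T ^^ k) (x i)" "y i (k - M)" "(T ^^ k) (v i)"] by linarith
    qed
    then show "k \<in> {k. B (\<lambda>i. (T ^^ k) (x i))}"
      using y(2)[of "k - M" "\<lambda>i. (T ^^ k) (x i)"] k(1) by auto
  qed
  then show "\<exists>v r'. r' > 0 \<and> (\<forall>i\<in>I. v i \<in> D \<and> dist (v i) (u i) < r) \<and>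
      (\<forall>y. (\<forall>i\<in>I. y i \<in> X \<and> dist (y i) (v i) < r') \<longrightarrow> often s {k. B (\<lambda>i. (T ^^ k) (y i))})"
    using r'(1) vD by blast
qed

lemma generically_often_close:
  assumes shad: "shadowing X T" and anch: "anchored D p P" and I: "finite I" and t: "t > 0"
  shows "generically X D I (\<lambda>x. often s {k. \<forall>i\<in>I. \<forall>j\<in>I. dist ((T ^^ k) (x i)) ((T ^^ k) (x j)) < t})"
proof (rule generically_often_if_traced[OF shad anch I half_gt_zero[OF t]])
  fix \<delta> :: real assume "\<delta> > 0"
  moreover have "p \<in> X" using anch by (simp add: anchored_def)
  ultimately have "pseudo_orbit X T \<delta> (\<lambda>k. (T ^^ k) p)" by (intro pseudo_orbit_orbit)
  moreover have "dist a b < t" if "dist a c < t / 2" "dist b c < t / 2" for a b c :: 'a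
    using that dist_triangle_half_l by blast
  ultimately show "\<exists>y k0. (\<forall>i\<in>I. pseudo_orbit X T \<delta> (y i) \<and> y i 0 = p) \<and>
      (\<forall>k\<ge>k0. \<forall>a. (\<forall>i\<in>I. dist (a i) (y i k) < t / 2) \<longrightarrow> (\<forall>i\<in>I. \<forall>j\<in>I. dist (a i) (a j) < t))"
    by (intro exI[of _ "\<lambda>_ k. (T ^^ k) p"] exI[of _ 0]) auto
qed

text \<open>
The \<open>i\<close>-th pseudo-orbit waits for \<open>i\<close> periods at \<open>p\<close> before it moves to \<open>z\<close>, so two of them are
eventually shifts of each other by at least \<open>1\<close> and at most \<open>n * P\<close> steps along the orbit of
\<open>z\<close>. The constant depends on \<open>z\<close>, hence on \<open>n\<close>, but not on the frequency parameter \<open>s\<close>.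
\<close>

lemma generically_often_separated:
  fixes n :: nat
  assumes trans: "topologically_transitive X T" and shad: "shadowing X T"
    and anch: "anchored D p P" and q: "q \<in> X" "q \<notin> forward_orbit T p"
  shows "\<exists>d>0. \<forall>s. generically X D {1..n} (\<lambda>x. often s {k. \<forall>i\<in>{1..n}. \<forall>j\<in>{1..n}.
           i < j \<longrightarrow> dist ((T ^^ k) (x i)) ((T ^^ k) (x j)) > d})"
proof -
  have p: "p \<in> X" "P > 0" "(T ^^ P) p = p" using anch by (auto simp: anchored_def)
  obtain z d where z: "z \<in> X" "d > 0"
    "\<And>k c. 1 \<le> c \<Longrightarrow> c \<le> n * P \<Longrightarrow> dist ((T ^^ k) z) ((T ^^ (k + c)) z) > d"
    using orbit_with_separated_shifts[OF trans shad p q, of "n * P"] by blast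
  have d4: "d / 4 > 0" using z by simp
  have "\<exists>y k0. (\<forall>i\<in>{1..n}. pseudo_orbit X T \<delta> (y i) \<and> y i 0 = p) \<and>
      (\<forall>k\<ge>k0. \<forall>a. (\<forall>i\<in>{1..n}. dist (a i) (y i k) < d / 4) \<longrightarrow>
        (\<forall>i\<in>{1..n}. \<forall>j\<in>{1..n}. i < j \<longrightarrow> dist (a i) (a j) > d / 2))"
    if \<delta>: "\<delta> > 0" for \<delta>
  proof -
    obtain l g where g: "chain X T \<delta> l g" "g 0 = p" "g l = z"
      using chain_between[OF trans \<delta> p(1) z(1)] by blast
    let ?h = "splice_at l g (\<lambda>k. (T ^^ k) z)"
    define y where "y i = splice_at (i * P) (\<lambda>k. (T ^^ k) p) ?h" for i
    have h: "pseudo_orbit X T \<delta> ?h" "?h 0 = p"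
      using pseudo_orbit_splice[OF g(1) pseudo_orbit_orbit[OF z(1) \<delta>]] g
        splice_at_0[of g l "\<lambda>k. (T ^^ k) z"] by simp_all
    have "(T ^^ (i * P)) p = p" for i by (rule funpow_mult_fixed[OF p(3)]) simp
    then have y: "pseudo_orbit X T \<delta> (y i)" "y i 0 = p" for i
      unfolding y_def using orbit_splice[OF p(1) \<delta> h(1)] h(2) by simp_all
    have y_late: "y i k = (T ^^ (k - i * P - l)) z" if "i * P + l \<le> k" for i k
    proof -
      have "k = i * P + (l + (k - i * P - l))" using that by simp
      then have "y i k = y i (i * P + (l + (k - i * P - l)))" by simp
      then show ?thesis unfolding y_def by (simp only: splice_at_add)
    qed
    have apart: "dist (y i k) (y j k) > d"
      if ij: "i < j" "j \<le> n" and k: "n * P + l \<le> k" for i j k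
    proof -
      have le: "i * P \<le> j * P" "j * P \<le> n * P" using ij by simp_all
      define c where "c = (j - i) * P"
      have c: "j * P = i * P + c" using ij(1) by (simp add: c_def flip: add_mult_distrib)
      have "c \<ge> 1" using ij(1) p(2) by (simp add: c_def)
      have "k - i * P - l = (k - j * P - l) + c" using le k c by linarith
      then show ?thesis
        using z(3)[OF \<open>c \<ge> 1\<close>, of "k - j * P - l"] le c k y_late[of i k] y_late[of j k]
        by (simp add: dist_commute)
    qed
    have "dist (a i) (a j) > d / 2"
      if "dist (y i k) (y j k) > d" "dist (a i) (y i k) < d / 4" "dist (a j) (y j k) < d / 4" for i j k a
      using that dist_triangle[of "y i k" "y j k" "a i"] dist_triangle[of "a i" "y j k" "a j"]
      by (simp add: dist_commute)
    note near = this
    show ?thesis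
    proof (intro exI conjI allI impI ballI)
      fix k a i j
      assume "n * P + l \<le> k" "\<forall>i\<in>{1..n}. dist (a i) (y i k) < d / 4"
        "i \<in> {1..n}" "j \<in> {1..n}" "i < j"
      then show "dist (a i) (a j) > d / 2" using near[OF apart] by simp
    qed (rule y)+
  qed
  then have "\<forall>s. generically X D {1..n} (\<lambda>x. often s {k. \<forall>i\<in>{1..n}. \<forall>j\<in>{1..n}.
           i < j \<longrightarrow> dist ((T ^^ k) (x i)) ((T ^^ k) (x j)) > d / 2})"
    by (intro allI generically_often_if_traced[OF shad anch _ d4]) auto
  then show ?thesis using z(2) by (meson half_gt_zero)
qed

end

section \<open>Parametrising a Mycielski set by binary sequences\<close>

text \<open>
Every point of \<open>D\<close> is approximated by arbitrarily late terms, so that precision may increase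
along the sequence. This is achieved by repeating each term of a countable dense set infinitely
often.
\<close>

lemma dense_sequence:
  fixes X :: "'a::metric_space set"
  assumes "compact X" "openin (top_of_set X) D" "D \<noteq> {}"
  shows "\<exists>d :: nat \<Rightarrow> 'a. (\<forall>j. d j \<in> D) \<and> (\<forall>x\<in>D. \<forall>e>0. \<forall>N. \<exists>j\<ge>N. dist (d j) x < e)"
proof -
  have "\<forall>n. \<exists>k. finite k \<and> X \<subseteq> (\<Union>x\<in>k. ball x (1 / real (Suc n))) \<and> k \<subseteq> X"
  proof
    fix n
    show "\<exists>k. finite k \<and> X \<subseteq> (\<Union>x\<in>k. ball x (1 / real (Suc n))) \<and> k \<subseteq> X"
      using seq_compact_imp_totally_bounded[OF compact_imp_seq_compact[OF assms(1)],
          THEN spec, THEN mp, of "1 / real (Suc n)"] by auto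
  qed
  then obtain net where net: "\<And>n. finite (net n)" "\<And>n. net n \<subseteq> X"
    "\<And>n. X \<subseteq> (\<Union>x\<in>net n. ball x (1 / real (Suc n)))"
    by metis
  define E where "E = D \<inter> (\<Union>n. net n)"
  have "countable E" unfolding E_def using net(1) by (intro countable_Int2 countable_UN) (auto intro: countable_finite)
  have dense: "\<exists>y\<in>E. dist y x < e" if x: "x \<in> D" and e: "e > 0" for x e
  proof -
    obtain a where a: "a > 0" "\<And>y. y \<in> X \<Longrightarrow> dist y x < a \<Longrightarrow> y \<in> D"
      using assms(2) x unfolding openin_euclidean_subtopology_iff by blast
    obtain n where n: "inverse (real (Suc n)) < min a e"
      using reals_Archimedean[of "min a e"] a(1) e by auto
    have "x \<in> X" using x assms(2) openin_imp_subset by blast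
    then obtain y where y: "y \<in> net n" "dist y x < 1 / real (Suc n)"
      using net(3)[of n] by auto
    then have yx: "dist y x < a" "dist y x < e" using n by (auto simp: inverse_eq_divide)
    then have "y \<in> D" using a(2) net(2) y(1) by blast
    then show ?thesis using y(1) yx(2) by (auto simp: E_def)
  qed
  then have "E \<noteq> {}" using assms(3) by (metis all_not_in_conv zero_less_one)
  define d where "d j = from_nat_into E (fst (prod_decode j))" for j
  have "d j \<in> D" for j
    using from_nat_into[OF \<open>E \<noteq> {}\<close>, of "fst (prod_decode j)"] by (auto simp: d_def E_def)
  moreover have "\<exists>j\<ge>N. dist (d j) x < e" if x: "x \<in> D" and e: "e > 0" for x e N
  proof -
    obtain y where y: "y \<in> E" "dist y x < e" using dense[OF x e] by blast
    obtain i where i: "from_nat_into E i = y"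
      using from_nat_into_surj[OF \<open>countable E\<close> y(1)] by blast
    have "prod_encode (i, N) \<ge> N" by (rule le_prod_encode_2)
    moreover have "d (prod_encode (i, N)) = y" by (simp add: d_def i)
    ultimately show ?thesis using y(2) by blast
  qed
  ultimately show ?thesis by blast
qed

text \<open>
The first component selects a Cantor set, the second one a point in it.
\<close>

type_synonym label = "nat \<times> (nat \<Rightarrow> bool)"

text \<open>
Truncated labels serve as canonical representatives of the labels with the same first \<open>s\<close>
digits, so the finite tree of stage \<open>s\<close> lives inside the label type.
\<close>

definition truncate :: "nat \<Rightarrow> label \<Rightarrow> label" where
  "truncate s l = (fst l, \<lambda>i. i < s \<and> snd l i)"

text \<open>
The Cantor sets enter the construction one at a time: at stage \<open>s\<close> those with index up to \<open>s\<close>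
are present.
\<close>

definition stage_labels :: "nat \<Rightarrow> label set" where
  "stage_labels s = {..s} \<times> {\<alpha>. \<forall>i\<ge>s. \<not> \<alpha> i}"

lemma fst_truncate [simp]: "fst (truncate s l) = fst l"
  by (simp add: truncate_def)

lemma truncate_truncate_Suc [simp]: "truncate s (truncate (Suc s) l) = truncate s l"
  by (auto simp: truncate_def)

lemma truncate_in_stage_labels: "fst l \<le> s \<Longrightarrow> truncate s l \<in> stage_labels s"
  by (auto simp: truncate_def stage_labels_def)

lemma truncate_stage_label: "l \<in> stage_labels s \<Longrightarrow> truncate s l = l"
  by (cases l) (auto simp: truncate_def stage_labels_def fun_eq_iff, meson leI)

lemma finite_stage_labels: "finite (stage_labels s)"
proof -
  have "{\<alpha>. \<forall>i\<ge>s. \<not> \<alpha> i} \<subseteq> (\<lambda>A i. i \<in> A) ` Pow {..<s}"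
  proof
    fix \<alpha> :: "nat \<Rightarrow> bool" assume "\<alpha> \<in> {\<alpha>. \<forall>i\<ge>s. \<not> \<alpha> i}"
    then have "\<alpha> = (\<lambda>i. i \<in> {i. \<alpha> i})" "{i. \<alpha> i} \<in> Pow {..<s}"
      by (auto intro: leI)
    then show "\<alpha> \<in> (\<lambda>A i. i \<in> A) ` Pow {..<s}" by (rule image_eqI)
  qed
  then have "finite {\<alpha>. \<forall>i\<ge>s. \<not> \<alpha> i}" using finite_surj by (metis finite_Pow_iff finite_lessThan)
  then show ?thesis by (simp add: stage_labels_def)
qed

lemma eventually_truncate_neq:
  assumes "l \<noteq> l'"
  shows "eventually (\<lambda>s. truncate s l \<noteq> truncate s l') sequentially"
proof (cases "fst l = fst l'")
  case True
  then obtain k where k: "snd l k \<noteq> snd l' k" using assms by (auto simp: prod_eq_iff fun_eq_iff)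
  have "truncate s l \<noteq> truncate s l'" if "s \<ge> Suc k" for s
  proof
    assume "truncate s l = truncate s l'"
    then have "(k < s \<and> snd l k) = (k < s \<and> snd l' k)"
      unfolding truncate_def prod.inject by meson
    then show False using k that by auto
  qed
  then show ?thesis unfolding eventually_sequentially by blast
next
  case False
  then have "truncate s l \<noteq> truncate s l'" for s by (metis fst_truncate)
  then show ?thesis by simp
qed

text \<open>
Only tuples of size up to \<open>s\<close> are asked for, which keeps the number of conditions finite.
\<close>

definition holds_on_injections ::
    "(nat \<Rightarrow> (nat \<Rightarrow> 'a) \<Rightarrow> bool) \<Rightarrow> nat \<Rightarrow> 'i set \<Rightarrow> ('i \<Rightarrow> 'a) \<Rightarrow> bool" where
  "holds_on_injections G s W y \<longleftrightarrow>
     (\<forall>n\<le>s. \<forall>t x. inj_on t {1..n} \<and> t ` {1..n} \<subseteq> W \<and> (\<forall>j\<in>{1..n}. x j = y (t j)) \<longrightarrow> G n x)"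

text \<open>
Up to values outside \<open>{1..n}\<close> there are only finitely many tuples in a finite set \<open>W\<close>.
\<close>

lemma generically_holds_on_injections:
  assumes "\<And>n. generically X D {1..n} (G n)" "finite W"
  shows "generically X D W (holds_on_injections G s W)"
proof -
  define A where "A = (SIGMA n:{..s}. {t \<in> {1..n} \<rightarrow>\<^sub>E W. inj_on t {1..n}})"
  have "finite A" unfolding A_def using assms(2) by (auto intro!: finite_SigmaI finite_PiE finite_Collect_conjI)
  then have "generically X D W (\<lambda>y. \<forall>a\<in>A. \<forall>x. (\<forall>j\<in>{1..fst a}. x j = y (snd a j)) \<longrightarrow> G (fst a) x)"
  proof (rule generically_ball)
    fix a assume "a \<in> A"
    then show "generically X D W (\<lambda>y. \<forall>x. (\<forall>j\<in>{1..fst a}. x j = y (snd a j)) \<longrightarrow> G (fst a) x)"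
      by (intro generically_pullback[OF assms(1)]) (auto simp: A_def)
  qed
  then show ?thesis
  proof (rule generically_mono)
    fix y assume y: "\<forall>a\<in>A. \<forall>x. (\<forall>j\<in>{1..fst a}. x j = y (snd a j)) \<longrightarrow> G (fst a) x"
    show "holds_on_injections G s W y"
      unfolding holds_on_injections_def
    proof (intro allI impI; elim conjE)
      fix n t x
      assume n: "n \<le> s" and t: "inj_on t {1..n}" "t ` {1..n} \<subseteq> W" and x: "\<forall>j\<in>{1..n}. x j = y (t j)"
      have "(n, restrict t {1..n}) \<in> A"
        using n t by (auto simp: A_def inj_on_restrict_eq)
      from bspec[OF y this] show "G n x" using x by simp
    qed
  qed
qed

lemma limit_of_shrinking_balls:
  fixes x :: "nat \<Rightarrow> 'a::metric_space"
  assumes "compact X" "\<And>s. x s \<in> X" "\<And>s. r s > 0" "\<And>s. r (Suc s) \<le> r s / 2"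
    "\<And>s. dist (x (Suc s)) (x s) < r s / 2"
  shows "\<exists>z\<in>X. \<forall>s. dist z (x s) \<le> r s"
proof -
  have le: "dist (x (s + k)) (x s) \<le> r s - r (s + k)" for s k
  proof (induction k)
    case (Suc k)
    have "dist (x (s + Suc k)) (x s) \<le> dist (x (Suc (s + k))) (x (s + k)) + dist (x (s + k)) (x s)"
      using dist_triangle by simp
    then show ?case using Suc assms(4)[of "s + k"] assms(5)[of "s + k"] by simp
  qed simp
  obtain z g where z: "z \<in> X" "strict_mono g" "(x \<circ> g) \<longlonglongrightarrow> z"
    using assms(1,2) unfolding compact_eq_seq_compact_metric by (metis seq_compactE)
  have "dist z (x s) \<le> r s" for s
  proof (rule LIMSEQ_le_const2)
    show "(\<lambda>k. dist ((x \<circ> g) k) (x s)) \<longlonglongrightarrow> dist z (x s)"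
      using z(3) by (intro tendsto_intros)
    have "dist ((x \<circ> g) k) (x s) \<le> r s" if "k \<ge> s" for k
    proof -
      have "g k \<ge> s" using seq_suble[OF z(2), of k] that by simp
      then have "s + (g k - s) = g k" by simp
      then show ?thesis using le[of s "g k - s"] assms(3)[of "g k"] by simp
    qed
    then show "\<exists>N. \<forall>k\<ge>N. dist ((x \<circ> g) k) (x s) \<le> r s" by blast
  qed
  then show ?thesis using z(1) by blast
qed

text \<open>
An approximation \<open>x\<close> with tolerance \<open>r\<close>. It depends only on the first \<open>s\<close> digits of a label, and
a Cantor set that has not yet entered is represented by its centre \<open>d j\<close>.
\<close>

definition stage_invariant ::
    "'a::metric_space set \<Rightarrow> (nat \<Rightarrow> 'a) \<Rightarrow> nat \<Rightarrow> (label \<Rightarrow> 'a) \<Rightarrow> real \<Rightarrow> bool" where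
  "stage_invariant D d s x r \<longleftrightarrow> r > 0 \<and> r \<le> 1 / (real s + 1) \<and> (\<forall>l. x l \<in> D) \<and>
     (\<forall>l. x (truncate s l) = x l) \<and> (\<forall>j\<ge>s. \<forall>\<alpha>. x (j, \<alpha>) = d j)"

text \<open>
For the labels present at stage \<open>s\<close> the new approximation still depends on \<open>s\<close> digits only, so
that a label may be replaced by its truncation. The factor \<open>2\<close> makes room for limits, whose
distance is at most the tolerance but perhaps not less.
\<close>

definition stage_refinement ::
    "'a::metric_space set \<Rightarrow> (nat \<Rightarrow> nat \<Rightarrow> (nat \<Rightarrow> 'a) \<Rightarrow> bool) \<Rightarrow> nat \<Rightarrow>
     (label \<Rightarrow> 'a) \<Rightarrow> real \<Rightarrow> (label \<Rightarrow> 'a) \<Rightarrow> real \<Rightarrow> bool" where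
  "stage_refinement X G s x r x' r' \<longleftrightarrow> r' \<le> r / 2 \<and> (\<forall>l. dist (x' l) (x l) < r / 2) \<and>
     (\<forall>l. fst l \<le> s \<longrightarrow> x' (truncate s l) = x' l) \<and>
     (\<forall>y. (\<forall>l\<in>stage_labels s. y l \<in> X \<and> dist (y l) (x' l) < 2 * r') \<longrightarrow>
        holds_on_injections (G s) s (stage_labels s) y)"

lemma stage_refinement_exists:
  assumes G: "\<And>s n. generically X D {1..n} (G s n)" and inv: "stage_invariant D d s x r"
  shows "\<exists>x' r'. stage_invariant D d (Suc s) x' r' \<and> stage_refinement X G s x r x' r'"
proof -
  have r: "r > 0" "r \<le> 1 / (real s + 1)" and xD: "\<And>l. x l \<in> D"
    and xt: "\<And>l. x (truncate s l) = x l" and xd: "\<And>j \<alpha>. j \<ge> s \<Longrightarrow> x (j, \<alpha>) = d j"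
    using inv by (auto simp: stage_invariant_def)
  have xD': "\<forall>l\<in>stage_labels s. x l \<in> D" using xD by blast
  obtain v b where v: "b > 0" "\<forall>l\<in>stage_labels s. v l \<in> D \<and> dist (v l) (x l) < r / 2"
    "\<And>y. \<forall>l\<in>stage_labels s. y l \<in> X \<and> dist (y l) (v l) < b \<Longrightarrow>
       holds_on_injections (G s) s (stage_labels s) y"
    by (rule genericallyE[OF generically_holds_on_injections[of X D "G s" "stage_labels s" s,
          OF G finite_stage_labels] xD' half_gt_zero[OF r(1)]]) (rule that; assumption)
  define x' where "x' l = (if fst l \<le> s then v (truncate s l) else x l)" for l
  \<comment> \<open>the bound \<open>b / 2\<close> provides the factor \<open>2\<close> in \<open>stage_refinement\<close>\<close>
  define r' where "r' = min (b / 2) (min (r / 2) (1 / (real (Suc s) + 1)))"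
  have r': "r' > 0" "r' \<le> r / 2" "r' \<le> 1 / (real (Suc s) + 1)" "2 * r' \<le> b"
    using r(1) v(1) by (auto simp: r'_def)
  have 1: "x' l \<in> D \<and> dist (x' l) (x l) < r / 2" for l
  proof (cases "fst l \<le> s")
    case True
    then show ?thesis
      using bspec[OF v(2) truncate_in_stage_labels[OF True]] xt[of l] by (simp add: x'_def)
  next
    case False
    then show ?thesis using xD r(1) by (simp add: x'_def)
  qed
  have 2: "x' (truncate (Suc s) l) = x' l" for l
  proof -
    have "x (truncate (Suc s) l) = x l"
      using xt[of "truncate (Suc s) l"] xt[of l] by simp
    then show ?thesis by (simp add: x'_def)
  qed
  have 3: "x' (j, \<alpha>) = d j" if "j \<ge> Suc s" for j \<alpha>
    using xd that by (simp add: x'_def)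
  have xv: "x' l = v l" if "l \<in> stage_labels s" for l
  proof -
    have "fst l \<le> s" using that by (auto simp: stage_labels_def)
    then show ?thesis using truncate_stage_label[OF that] by (simp add: x'_def)
  qed
  have 4: "x' (truncate s l) = x' l" if "fst l \<le> s" for l
    using xv[OF truncate_in_stage_labels[OF that]] that by (simp add: x'_def)
  have 5: "holds_on_injections (G s) s (stage_labels s) y"
    if y: "\<forall>l\<in>stage_labels s. y l \<in> X \<and> dist (y l) (x' l) < 2 * r'" for y
  proof (rule v(3), rule ballI)
    fix l assume l: "l \<in> stage_labels s"
    show "y l \<in> X \<and> dist (y l) (v l) < b"
      using bspec[OF y l] r'(4) unfolding xv[OF l] by simp
  qed
  have "stage_invariant D d (Suc s) x' r'"
    unfolding stage_invariant_def using 1 2 3 r' by blast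
  moreover have "stage_refinement X G s x r x' r'"
    unfolding stage_refinement_def using 1 4 5 r' by blast
  ultimately show ?thesis by blast
qed

lemma mycielski_stages:
  assumes G: "\<And>s n. generically X D {1..n} (G s n)" and d: "\<And>j. d j \<in> D"
  obtains x r where "\<And>s. stage_invariant D d s (x s) (r s)"
    "\<And>s. stage_refinement X G s (x s) (r s) (x (Suc s)) (r (Suc s))"
proof -
  have "\<exists>f. \<forall>s. stage_invariant D d s (fst (f s)) (snd (f s)) \<and>
      stage_refinement X G s (fst (f s)) (snd (f s)) (fst (f (Suc s))) (snd (f (Suc s)))"
  proof (rule dependent_nat_choice)
    show "\<exists>a. stage_invariant D d 0 (fst a) (snd a)"
      by (intro exI[of _ "(\<lambda>l. d (fst l), 1)"]) (simp add: stage_invariant_def d)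
    show "\<exists>b. stage_invariant D d (Suc s) (fst b) (snd b) \<and> stage_refinement X G s (fst a) (snd a) (fst b) (snd b)"
      if "stage_invariant D d s (fst a) (snd a)" for a s
      using stage_refinement_exists[OF G that] by auto
  qed
  then show ?thesis using that[of "\<lambda>s. fst (f s)" "\<lambda>s. snd (f s)" for f] by blast
qed

text \<open>
Mycielski's theorem for the conditions \<open>G s n\<close>, in the form of a continuous map on labels. The
Cantor set with index \<open>j\<close> starts at \<open>d j\<close> with tolerance \<open>1/(j+1)\<close>, and the terms \<open>d j\<close> with
large \<open>j\<close> are still dense, so the range is dense in \<open>D\<close>. Distinct labels have distinct truncations
from some stage on, and from then on each stage takes care of the tuple.
\<close>

theorem mycielski_parametrisation:
  fixes X :: "'a::metric_space set" and G :: "nat \<Rightarrow> nat \<Rightarrow> (nat \<Rightarrow> 'a) \<Rightarrow> bool"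
  assumes X: "compact X" and D: "openin (top_of_set X) D" "D \<noteq> {}"
    and G: "\<And>s n. generically X D {1..n} (G s n)"
  obtains \<phi> :: "label \<Rightarrow> 'a" where "range \<phi> \<subseteq> X" "D \<subseteq> closure (range \<phi>)"
    "\<And>j s \<alpha> \<beta>. \<forall>i<s. \<alpha> i = \<beta> i \<Longrightarrow> dist (\<phi> (j, \<alpha>)) (\<phi> (j, \<beta>)) \<le> 2 / (real s + 1)"
    "\<And>n l. inj_on l {1..n} \<Longrightarrow> \<exists>s0. \<forall>s\<ge>s0. G s n (\<lambda>i. \<phi> (l i))"
proof -
  obtain d :: "nat \<Rightarrow> 'a" where d: "\<And>j. d j \<in> D" "\<And>x e N. x \<in> D \<Longrightarrow> e > 0 \<Longrightarrow> \<exists>j\<ge>N. dist (d j) x < e"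
    using dense_sequence[OF X D] by blast
  obtain x r where inv: "\<And>s. stage_invariant D d s (x s) (r s)"
    and ref: "\<And>s. stage_refinement X G s (x s) (r s) (x (Suc s)) (r (Suc s))"
    by (rule mycielski_stages[OF G d(1)]) (rule that; assumption)
  have r: "r s > 0" "r s \<le> 1 / (real s + 1)" "r (Suc s) \<le> r s / 2" for s
    using inv[of s] ref[of s] by (simp_all add: stage_invariant_def stage_refinement_def)
  have x: "x s l \<in> D" "x s (truncate s l) = x s l" "j \<ge> s \<Longrightarrow> x s (j, \<alpha>) = d j"
    "dist (x (Suc s) l) (x s l) < r s / 2" "fst l \<le> s \<Longrightarrow> x (Suc s) (truncate s l) = x (Suc s) l"
    for s l j \<alpha>
    using inv[of s] ref[of s] unfolding stage_invariant_def stage_refinement_def by blast+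
  have good: "holds_on_injections (G s) s (stage_labels s) y"
    if "\<forall>l\<in>stage_labels s. y l \<in> X \<and> dist (y l) (x (Suc s) l) < 2 * r (Suc s)" for s y
    using ref[of s] that unfolding stage_refinement_def by blast
  have xX: "x s l \<in> X" for s l using x(1) D(1) openin_imp_subset by blast
  have "\<exists>z\<in>X. \<forall>s. dist z (x s l) \<le> r s" for l
    using limit_of_shrinking_balls[OF X, of "\<lambda>s. x s l" r] r xX x(4) by blast
  then obtain \<phi> where \<phi>: "\<And>l. \<phi> l \<in> X" "\<And>l s. dist (\<phi> l) (x s l) \<le> r s" by metis
  have "D \<subseteq> closure (range \<phi>)"
  proof
    fix y assume y: "y \<in> D"
    show "y \<in> closure (range \<phi>)"
      unfolding closure_approachable
    proof (intro allI impI)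
      fix e :: real assume e: "e > 0"
      obtain N where N: "inverse (real (Suc N)) < e / 2"
        using reals_Archimedean[of "e / 2"] e by auto
      obtain j where j: "j \<ge> N" "dist (d j) y < e / 2" using d(2)[OF y, of "e / 2" N] e by auto
      \<comment> \<open>any point of the \<open>j\<close>-th Cantor set will do\<close>
      let ?l = "(j, \<lambda>_. False)"
      have "r j \<le> 1 / (real N + 1)"
        using j(1) by (intro order_trans[OF r(2)[of j]]) (simp add: frac_le)
      then have "dist (\<phi> ?l) (d j) < e / 2"
        using \<phi>(2)[of ?l j] x(3)[of j j] N by (simp add: inverse_eq_divide add.commute)
      then have "dist (\<phi> ?l) y < e"
        using j(2) dist_triangle[of "\<phi> ?l" y "d j"] by linarith
      then show "\<exists>z\<in>range \<phi>. dist z y < e" by blast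
    qed
  qed
  moreover have "dist (\<phi> (j, \<alpha>)) (\<phi> (j, \<beta>)) \<le> 2 / (real s + 1)" if "\<forall>i<s. \<alpha> i = \<beta> i" for j s \<alpha> \<beta>
  proof -
    have "truncate s (j, \<alpha>) = truncate s (j, \<beta>)" using that by (auto simp: truncate_def)
    then have "x s (j, \<alpha>) = x s (j, \<beta>)" by (metis x(2))
    then have "dist (\<phi> (j, \<alpha>)) (\<phi> (j, \<beta>)) \<le> 2 * r s"
      using \<phi>(2)[of "(j, \<alpha>)" s] \<phi>(2)[of "(j, \<beta>)" s]
        dist_triangle2[of "\<phi> (j, \<alpha>)" "\<phi> (j, \<beta>)" "x s (j, \<beta>)"] by simp
    then show ?thesis using r(2)[of s] by simp
  qed
  moreover have "\<exists>s0. \<forall>s\<ge>s0. G s n (\<lambda>i. \<phi> (l i))" if l: "inj_on l {1..n}" for n l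
  proof -
    have "eventually (\<lambda>s. \<forall>i\<in>{1..n}. \<forall>j\<in>{1..n}. i \<noteq> j \<longrightarrow> truncate s (l i) \<noteq> truncate s (l j)) sequentially"
    proof (intro eventually_ball_finite ballI)
      fix i j assume "i \<in> {1..n}" "j \<in> {1..n}"
      then show "eventually (\<lambda>s. i \<noteq> j \<longrightarrow> truncate s (l i) \<noteq> truncate s (l j)) sequentially"
        using eventually_truncate_neq[of "l i" "l j"] l by (cases "i = j") (auto simp: inj_on_eq_iff)
    qed auto
    moreover have "eventually (\<lambda>s. \<forall>i\<in>{1..n}. fst (l i) \<le> s) sequentially"
      by (intro eventually_ball_finite ballI eventually_ge_at_top) auto
    moreover have "eventually (\<lambda>s. n \<le> s) sequentially" by (rule eventually_ge_at_top)
    ultimately have "eventually (\<lambda>s. G s n (\<lambda>i. \<phi> (l i))) sequentially"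
    proof eventually_elim
      case (elim s)
      define t where "t i = truncate s (l i)" for i
      have inj: "inj_on t {1..n}" using elim(1) unfolding inj_on_def t_def by blast
      have t: "t i \<in> stage_labels s" if "i \<in> {1..n}" for i
        using elim(2) that unfolding t_def by (intro truncate_in_stage_labels) blast
      \<comment> \<open>a family on the truncated labels that passes through the given points\<close>
      define y where "y w = (if w \<in> t ` {1..n} then \<phi> (l (the_inv_into {1..n} t w)) else x (Suc s) w)" for w
      have y: "y (t i) = \<phi> (l i)" if "i \<in> {1..n}" for i
        using that the_inv_into_f_f[OF inj that] by (simp add: y_def)
      have "\<forall>w\<in>stage_labels s. y w \<in> X \<and> dist (y w) (x (Suc s) w) < 2 * r (Suc s)"
      proof
        fix w assume "w \<in> stage_labels s"
        show "y w \<in> X \<and> dist (y w) (x (Suc s) w) < 2 * r (Suc s)"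
        proof (cases "w \<in> t ` {1..n}")
          case True
          then obtain i where i: "i \<in> {1..n}" "w = t i" by blast
          have "x (Suc s) w = x (Suc s) (l i)"
            using x(5) elim(2) i unfolding t_def by blast
          then show ?thesis
            using y[OF i(1)] i(2) \<phi>(1) \<phi>(2)[of "l i" "Suc s"] r(1)[of "Suc s"] by simp
        next
          case False
          then show ?thesis using xX r(1)[of "Suc s"] by (simp add: y_def)
        qed
      qed
      then have "holds_on_injections (G s) s (stage_labels s) y" by (rule good)
      then show ?case
        unfolding holds_on_injections_def using elim(3) inj t y by (metis image_subsetI)
    qed
    then show ?thesis unfolding eventually_sequentially .
  qed
  ultimately show ?thesis using that[of \<phi>] \<phi>(1) by blast
qed

section \<open>The Cantor ternary set and binary sequences\<close>

lemma compact_binary_sequences: "compact (UNIV :: (nat \<Rightarrow> bool) set)"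
proof -
  have "compact_space (product_topology (\<lambda>_::nat. euclidean :: bool topology) UNIV)"
    unfolding compact_space_product_topology
    by (simp add: compact_space_def finite_imp_compact)
  then show ?thesis
    unfolding euclidean_product_topology compact_space_def by simp
qed

lemma continuous_on_binary_sequences:
  fixes f :: "(nat \<Rightarrow> bool) \<Rightarrow> 'a::metric_space"
  assumes "\<And>e. e > 0 \<Longrightarrow> \<exists>s. \<forall>\<alpha> \<beta>. (\<forall>i<s. \<alpha> i = \<beta> i) \<longrightarrow> dist (f \<alpha>) (f \<beta>) < e"
  shows "continuous_on UNIV f"
  unfolding continuous_on_def
proof (intro ballI tendstoI)
  fix \<alpha> and e :: real assume "e > 0"
  then obtain s where s: "\<And>\<alpha> \<beta>. (\<forall>i<s. \<alpha> i = \<beta> i) \<Longrightarrow> dist (f \<alpha>) (f \<beta>) < e"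
    using assms by blast
  have "open {\<beta> :: nat \<Rightarrow> bool. \<forall>i\<in>{..<s}. \<beta> i \<in> {\<alpha> i}}"
    by (rule product_topology_basis') (auto intro: open_discrete)
  moreover have "\<alpha> \<in> {\<beta>. \<forall>i\<in>{..<s}. \<beta> i \<in> {\<alpha> i}}" by simp
  moreover have "dist (f \<beta>) (f \<alpha>) < e" if "\<beta> \<in> {\<beta>. \<forall>i\<in>{..<s}. \<beta> i \<in> {\<alpha> i}}" for \<beta>
    using that by (intro s) simp
  ultimately show "eventually (\<lambda>\<beta>. dist (f \<beta>) (f \<alpha>) < e) (at \<alpha> within UNIV)"
    unfolding eventually_at_topological by blast
qed

lemma homeomorphic_binary_sequences:
  fixes f :: "(nat \<Rightarrow> bool) \<Rightarrow> 'a::metric_space"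
  assumes "inj f"
    and "\<And>e. e > 0 \<Longrightarrow> \<exists>s. \<forall>\<alpha> \<beta>. (\<forall>i<s. \<alpha> i = \<beta> i) \<longrightarrow> dist (f \<alpha>) (f \<beta>) < e"
  shows "(UNIV :: (nat \<Rightarrow> bool) set) homeomorphic range f"
  by (rule homeomorphic_compact[OF compact_binary_sequences
        continuous_on_binary_sequences[OF assms(2)] refl assms(1)])

definition ternary :: "(nat \<Rightarrow> bool) \<Rightarrow> nat \<Rightarrow> real" where
  "ternary \<alpha> n = (if \<alpha> n then 2 else 0) / 3 ^ Suc n"

lemma ternary_tail_sums: "(\<lambda>n. 2 / 3 ^ Suc (n + s)) sums (1 / 3 ^ s :: real)"
proof -
  have "(\<lambda>n. 2 / 3 ^ Suc s * (1 / 3) ^ n) sums (2 / 3 ^ Suc s * (1 / (1 - 1 / 3)) :: real)"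
    by (intro sums_mult geometric_sums) simp
  then show ?thesis by (simp add: power_add field_simps)
qed

lemma summable_ternary: "summable (\<lambda>n. ternary \<alpha> (n + s))"
  by (rule summable_comparison_test_ev[OF always_eventually sums_summable[OF ternary_tail_sums[of s]]])
    (simp add: ternary_def)

lemma ternary_tail_bounds: "0 \<le> (\<Sum>n. ternary \<alpha> (n + s))" "(\<Sum>n. ternary \<alpha> (n + s)) \<le> 1 / 3 ^ s"
proof -
  show "0 \<le> (\<Sum>n. ternary \<alpha> (n + s))"
    by (intro suminf_nonneg summable_ternary) (simp add: ternary_def)
  have "(\<Sum>n. ternary \<alpha> (n + s)) \<le> (\<Sum>n. 2 / 3 ^ Suc (n + s))"
    by (intro suminf_le summable_ternary sums_summable[OF ternary_tail_sums]) (simp add: ternary_def)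
  also have "\<dots> = 1 / 3 ^ s" by (rule sums_unique[OF ternary_tail_sums, symmetric])
  finally show "(\<Sum>n. ternary \<alpha> (n + s)) \<le> 1 / 3 ^ s" .
qed

lemma ternary_split: "(\<Sum>n. ternary \<alpha> n) = (\<Sum>n<s. ternary \<alpha> n) + (\<Sum>n. ternary \<alpha> (n + s))"
  using suminf_split_initial_segment[OF summable_ternary[of \<alpha> 0, simplified], of s] by simp

text \<open>
At the first difference, one sequence gains \<open>2/3^(k+1)\<close>, while all later digits together are worth
at most half of this. So the ternary value respects the lexicographic order.
\<close>

lemma ternary_less:
  assumes "\<And>i. i < k \<Longrightarrow> \<alpha> i = \<beta> i" "\<alpha> k" "\<not> \<beta> k"
  shows "(\<Sum>n. ternary \<beta> n) < (\<Sum>n. ternary \<alpha> n)"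
proof -
  have "(\<Sum>n<k. ternary \<alpha> n) = (\<Sum>n<k. ternary \<beta> n)"
    using assms(1) by (intro sum.cong) (auto simp: ternary_def)
  then have "(\<Sum>n<Suc k. ternary \<alpha> n) = (\<Sum>n<Suc k. ternary \<beta> n) + 2 / 3 ^ Suc k"
    using assms(2,3) by (simp add: ternary_def)
  then have "(\<Sum>n. ternary \<beta> n) + 2 / 3 ^ Suc k \<le> (\<Sum>n. ternary \<alpha> n) + 1 / 3 ^ Suc k"
    using ternary_split[of \<alpha> "Suc k"] ternary_split[of \<beta> "Suc k"]
      ternary_tail_bounds(1)[of \<alpha> "Suc k"] ternary_tail_bounds(2)[of \<beta> "Suc k"] by linarith
  moreover have "(1::real) / 3 ^ Suc k < 2 / 3 ^ Suc k" by (intro divide_strict_right_mono) auto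
  ultimately show ?thesis by linarith
qed

lemma inj_ternary: "inj (\<lambda>\<alpha>. \<Sum>n. ternary \<alpha> n)"
proof (rule injI, rule ccontr)
  fix \<alpha> \<beta> :: "nat \<Rightarrow> bool"
  assume eq: "(\<Sum>n. ternary \<alpha> n) = (\<Sum>n. ternary \<beta> n)" and "\<alpha> \<noteq> \<beta>"
  then obtain m where "\<alpha> m \<noteq> \<beta> m" unfolding fun_eq_iff by blast
  define k where "k = (LEAST m. \<alpha> m \<noteq> \<beta> m)"
  have k: "\<alpha> k \<noteq> \<beta> k" unfolding k_def using \<open>\<alpha> m \<noteq> \<beta> m\<close> by (rule LeastI)
  have less: "\<alpha> i = \<beta> i" if "i < k" for i using not_less_Least[of i "\<lambda>m. \<alpha> m \<noteq> \<beta> m"] that unfolding k_def by simp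
  show False
  proof (cases "\<alpha> k")
    case True
    then show False using ternary_less[of k \<alpha> \<beta>, OF less] k eq by simp
  next
    case False
    then show False using ternary_less[of k \<beta> \<alpha>, OF less[symmetric]] k eq by simp
  qed
qed

lemma range_ternary: "range (\<lambda>\<alpha>. \<Sum>n. ternary \<alpha> n) = cantor_ternary_set"
proof (intro equalityI subsetI)
  fix x assume "x \<in> range (\<lambda>\<alpha>. \<Sum>n. ternary \<alpha> n)"
  then obtain \<alpha> where x: "x = (\<Sum>n. ternary \<alpha> n)" by blast
  have "ternary \<alpha> sums x" unfolding x using summable_sums[OF summable_ternary[of \<alpha> 0]] by simp
  then show "x \<in> cantor_ternary_set"
    unfolding cantor_ternary_set_def ternary_def
    by (intro CollectI exI[of _ "\<lambda>n. if \<alpha> n then 2 else 0"]) auto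
next
  fix x assume "x \<in> cantor_ternary_set"
  then obtain a :: "nat \<Rightarrow> real" where a: "\<And>n. a n \<in> {0, 2}" "(\<lambda>n. a n / 3 ^ Suc n) sums x"
    unfolding cantor_ternary_set_def by blast
  have "ternary (\<lambda>n. a n = 2) = (\<lambda>n. a n / 3 ^ Suc n)"
  proof
    show "ternary (\<lambda>n. a n = 2) n = a n / 3 ^ Suc n" for n
      using a(1)[of n] by (auto simp: ternary_def)
  qed
  then have "x = (\<Sum>n. ternary (\<lambda>n. a n = 2) n)" using sums_unique[OF a(2)] by simp
  then show "x \<in> range (\<lambda>\<alpha>. \<Sum>n. ternary \<alpha> n)" by blast
qed

text \<open>
A binary sequence is sent to the number with the ternary digits \<open>0\<close> and \<open>2\<close>. Sequences that agree
in the first \<open>s\<close> digits have values at most \<open>1/3^s\<close> apart, and compactness of the space of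
sequences makes a continuous bijection a homeomorphism.
\<close>

lemma homeomorphic_cantor_ternary_set: "(UNIV :: (nat \<Rightarrow> bool) set) homeomorphic cantor_ternary_set"
  unfolding range_ternary[symmetric]
proof (rule homeomorphic_binary_sequences[OF inj_ternary])
  fix e :: real assume "e > 0"
  then obtain s where s: "(1 / 3 :: real) ^ s < e" using real_arch_pow_inv[of e "1 / 3"] by auto
  have "dist (\<Sum>n. ternary \<alpha> n) (\<Sum>n. ternary \<beta> n) < e" if "\<forall>i<s. \<alpha> i = \<beta> i" for \<alpha> \<beta>
  proof -
    have "(\<Sum>n<s. ternary \<alpha> n) = (\<Sum>n<s. ternary \<beta> n)"
      using that by (intro sum.cong) (auto simp: ternary_def)
    then have "\<bar>(\<Sum>n. ternary \<alpha> n) - (\<Sum>n. ternary \<beta> n)\<bar> \<le> 1 / 3 ^ s"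
      using ternary_split[of \<alpha> s] ternary_split[of \<beta> s]
        ternary_tail_bounds[of \<alpha> s] ternary_tail_bounds[of \<beta> s] by linarith
    then show ?thesis using s by (simp add: dist_real_def power_one_over)
  qed
  then show "\<exists>s. \<forall>\<alpha> \<beta>. (\<forall>i<s. \<alpha> i = \<beta> i) \<longrightarrow> dist (\<Sum>n. ternary \<alpha> n) (\<Sum>n. ternary \<beta> n) < e"
    by (intro exI[of _ s] allI impI)
qed

lemma cantor_subset_range:
  fixes f :: "(nat \<Rightarrow> bool) \<Rightarrow> 'a::metric_space"
  assumes "inj f" "range f \<subseteq> X"
    and "\<And>e. e > 0 \<Longrightarrow> \<exists>s. \<forall>\<alpha> \<beta>. (\<forall>i<s. \<alpha> i = \<beta> i) \<longrightarrow> dist (f \<alpha>) (f \<beta>) < e"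
  shows "cantor_subset X (range f)"
  unfolding cantor_subset_def
proof
  have "range f homeomorphic (UNIV :: (nat \<Rightarrow> bool) set)"
    by (rule iffD1[OF homeomorphic_sym homeomorphic_binary_sequences[OF assms(1,3)]])
  then show "range f homeomorphic cantor_ternary_set"
    using homeomorphic_cantor_ternary_set by (rule homeomorphic_trans)
qed (rule assms(2))

text \<open>
Cantor's diagonal argument, transported from binary sequences.
\<close>

lemma uncountable_cantor_subset:
  assumes "cantor_subset X C"
  shows "uncountable C"
proof
  assume "countable C"
  have "C homeomorphic cantor_ternary_set" using assms by (simp add: cantor_subset_def)
  then have "C homeomorphic (UNIV :: (nat \<Rightarrow> bool) set)"
    by (rule homeomorphic_trans) (rule iffD1[OF homeomorphic_sym homeomorphic_cantor_ternary_set])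
  then obtain f :: "'a \<Rightarrow> nat \<Rightarrow> bool" and g where "homeomorphism C UNIV f g"
    unfolding homeomorphic_def by (elim exE)
  then have f: "f ` C = UNIV" by (rule homeomorphism_image1)
  then have "countable (UNIV :: (nat \<Rightarrow> bool) set)" using countable_image[OF \<open>countable C\<close>, of f] f by simp
  then obtain h :: "nat \<Rightarrow> nat \<Rightarrow> bool" where h: "range h = UNIV"
    using range_from_nat_into[of "UNIV :: (nat \<Rightarrow> bool) set"] by blast
  have "(\<lambda>i. \<not> h i i) \<in> range h" unfolding h by simp
  then obtain n where "(\<lambda>i. \<not> h i i) = h n" by (rule rangeE)
  then have "(\<not> h n n) = h n n" by (rule fun_cong)
  then show False by simp
qed

section \<open>Scrambled Mycielski sets\<close>

text \<open>
For fixed \<open>j\<close> the map is a continuous injection of binary sequences; the images for the countably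
many \<open>j\<close> are the Cantor sets.
\<close>

lemma mycielski_subset_range:
  fixes \<phi> :: "label \<Rightarrow> 'a::metric_space"
  assumes "inj \<phi>" "range \<phi> \<subseteq> X"
    and close: "\<And>j s \<alpha> \<beta>. (\<forall>i<s. \<alpha> i = \<beta> i) \<Longrightarrow> dist (\<phi> (j, \<alpha>)) (\<phi> (j, \<beta>)) \<le> 2 / (real s + 1)"
  shows "mycielski_subset X (range \<phi>)"
  unfolding mycielski_subset_def
proof (intro exI conjI ballI)
  let ?C = "\<lambda>j. range (\<lambda>\<alpha>. \<phi> (j, \<alpha>))"
  show "countable (range ?C)" "range ?C \<noteq> {}" by auto
  show "range \<phi> = \<Union> (range ?C)" by auto
  fix C assume "C \<in> range ?C"
  then obtain j where C: "C = ?C j" by blast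
  show "cantor_subset X C"
    unfolding C
  proof (rule cantor_subset_range)
    show "inj (\<lambda>\<alpha>. \<phi> (j, \<alpha>))"
      using assms(1) by (auto simp: inj_on_def)
    show "range (\<lambda>\<alpha>. \<phi> (j, \<alpha>)) \<subseteq> X" using assms(2) by blast
    fix e :: real assume "e > 0"
    then obtain s where s: "inverse (real (Suc s)) < e / 2"
      using reals_Archimedean[of "e / 2"] by auto
    have "dist (\<phi> (j, \<alpha>)) (\<phi> (j, \<beta>)) < e" if "\<forall>i<s. \<alpha> i = \<beta> i" for \<alpha> \<beta>
    proof -
      have "2 / (real s + 1) = 2 * inverse (real (Suc s))" by (simp add: inverse_eq_divide add.commute)
      then show ?thesis using close[OF that, of j] s by linarith
    qed
    then show "\<exists>s. \<forall>\<alpha> \<beta>. (\<forall>i<s. \<alpha> i = \<beta> i) \<longrightarrow> dist (\<phi> (j, \<alpha>)) (\<phi> (j, \<beta>)) < e"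
      by (intro exI[of _ s] allI impI)
  qed
qed

context dyn_system
begin

text \<open>
The conditions fed into Mycielski's theorem are closeness within \<open>1/(s+1)\<close> and separation by
\<open>d n\<close>, each for a proportion \<open>1 - 1/(s+1)\<close> of some long initial segment. Satisfying them for all
large \<open>s\<close> gives upper density one. Separation of pairs also shows that distinct labels have
distinct points, so tuples of points and tuples of labels correspond.
\<close>

theorem dense_scrambled_mycielski_set:
  assumes trans: "topologically_transitive X T" and shad: "shadowing X T"
    and anch: "anchored D p P" and q: "q \<in> X" "q \<notin> forward_orbit T p"
  shows "\<exists>K. mycielski_subset X K \<and> D \<subseteq> closure K \<and>
           (\<forall>n\<ge>2. \<exists>\<delta>>0. distributionally_scrambled X T n \<delta> K)"
proof -
  define near where "near n t x = {k. \<forall>i\<in>{1..n}. \<forall>j\<in>{1..n}. dist ((T ^^ k) (x i)) ((T ^^ k) (x j)) < t}"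
    for n :: nat and t :: real and x :: "nat \<Rightarrow> 'a"
  define far where "far n t x = {k. \<forall>i\<in>{1..n}. \<forall>j\<in>{1..n}. i < j \<longrightarrow> dist ((T ^^ k) (x i)) ((T ^^ k) (x j)) > t}"
    for n :: nat and t :: real and x :: "nat \<Rightarrow> 'a"
  have "\<forall>n. \<exists>d>0. \<forall>s. generically X D {1..n} (\<lambda>x. often s (far n d x))"
    using generically_often_separated[OF trans shad anch q] unfolding far_def by blast
  then obtain d where d: "\<And>n. d n > 0" "\<And>n s. generically X D {1..n} (\<lambda>x. often s (far n (d n) x))"
    by metis
  define G where "G s n x \<longleftrightarrow> often s (near n (1 / (real s + 1)) x) \<and> often s (far n (d n) x)"
    for s n x
  have G: "generically X D {1..n} (G s n)" for s n
  proof -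
    have "generically X D {1..n} (\<lambda>x. often s (near n (1 / (real s + 1)) x))"
      unfolding near_def by (intro generically_often_close[OF shad anch]) auto
    from generically_conj[OF this d(2)] show ?thesis by (simp add: G_def[abs_def])
  qed
  have D: "openin (top_of_set X) D" "D \<noteq> {}" using anch by (auto simp: anchored_def)
  obtain \<phi> :: "label \<Rightarrow> 'a" where \<phi>: "range \<phi> \<subseteq> X" "D \<subseteq> closure (range \<phi>)"
    "\<And>j s \<alpha> \<beta>. (\<forall>i<s. \<alpha> i = \<beta> i) \<Longrightarrow> dist (\<phi> (j, \<alpha>)) (\<phi> (j, \<beta>)) \<le> 2 / (real s + 1)"
    "\<And>n l. inj_on l {1..n} \<Longrightarrow> \<exists>s0. \<forall>s\<ge>s0. G s n (\<lambda>i. \<phi> (l i))"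
  proof (rule mycielski_parametrisation[where G = G, OF compact D G])
    fix \<phi> :: "label \<Rightarrow> 'a"
    assume "range \<phi> \<subseteq> X" "D \<subseteq> closure (range \<phi>)"
      "\<And>j s \<alpha> \<beta>. \<forall>i<s. \<alpha> i = \<beta> i \<Longrightarrow> dist (\<phi> (j, \<alpha>)) (\<phi> (j, \<beta>)) \<le> 2 / (real s + 1)"
      "\<And>n l. inj_on l {1..n} \<Longrightarrow> \<exists>s0. \<forall>s\<ge>s0. G s n (\<lambda>i. \<phi> (l i))"
    then show thesis by (rule that)
  qed
  have "inj \<phi>"
  proof (rule injI, rule ccontr)
    fix a b assume eq: "\<phi> a = \<phi> b" and "a \<noteq> b"
    then have "inj_on (\<lambda>i::nat. if i = 1 then a else b) {1..2}" by (auto simp: inj_on_def)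
    then obtain s0 where "\<forall>s\<ge>s0. G s 2 (\<lambda>i. \<phi> (if i = 1 then a else b))" using \<phi>(4) by blast
    then have "G (Suc s0) 2 (\<lambda>i. \<phi> (if i = 1 then a else b))" by simp
    then have "far 2 (d 2) (\<lambda>i. \<phi> (if i = 1 then a else b)) \<noteq> {}"
      unfolding G_def using often_nonempty by blast
    then obtain k where k: "k \<in> far 2 (d 2) (\<lambda>i. \<phi> (if i = 1 then a else b))" by blast
    have "d 2 < dist ((T ^^ k) (\<phi> a)) ((T ^^ k) (\<phi> b))"
      using k[unfolded far_def, THEN CollectD, THEN bspec, of 1, THEN bspec, of 2] by simp
    then show False using d(1)[of 2] eq by simp
  qed
  have "distributionally_scrambled X T n (d n) (range \<phi>)" for n
    unfolding distributionally_scrambled_def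
  proof (intro conjI allI impI; (elim conjE)?)
    fix x :: "nat \<Rightarrow> 'a" assume x: "x ` {1..n} \<subseteq> range \<phi>" "inj_on x {1..n}"
    then have "\<forall>i\<in>{1..n}. \<exists>l. x i = \<phi> l" by blast
    then obtain l where l: "\<And>i. i \<in> {1..n} \<Longrightarrow> x i = \<phi> (l i)" by metis
    have "inj_on l {1..n}"
    proof (rule inj_onI)
      fix i j assume "i \<in> {1..n}" "j \<in> {1..n}" "l i = l j"
      then show "i = j" using l x(2) by (metis inj_onD)
    qed
    then obtain s0 where s0: "\<And>s. s \<ge> s0 \<Longrightarrow> G s n (\<lambda>i. \<phi> (l i))" using \<phi>(4) by blast
    have "far n (d n) (\<lambda>i. \<phi> (l i)) = far n (d n) x" "near n t (\<lambda>i. \<phi> (l i)) = near n t x" for t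
      using l by (simp_all add: far_def near_def)
    then have often: "often s (far n (d n) x)" "often s (near n (1 / (real s + 1)) x)"
      if "s \<ge> s0" for s
      using s0[OF that] by (simp_all add: G_def)
    show "upper_density {k. \<forall>i\<in>{1..n}. \<forall>j\<in>{1..n}. i < j \<longrightarrow>
            dist ((T ^^ k) (x i)) ((T ^^ k) (x j)) > d n} = 1"
      using often(1) unfolding far_def by (rule upper_density_eq_1)
    fix t :: real assume "t > 0"
    then obtain N where N: "inverse (real (Suc N)) < t" using reals_Archimedean by blast
    show "upper_density {k. \<forall>i\<in>{1..n}. \<forall>j\<in>{1..n}. i < j \<longrightarrow>
            dist ((T ^^ k) (x i)) ((T ^^ k) (x j)) < t} = 1"
    proof (rule upper_density_eq_1[of "max s0 N"])
      fix s assume s: "s \<ge> max s0 N"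
      have "1 / (real s + 1) \<le> 1 / (real N + 1)" using s by (simp add: frac_le)
      then have "1 / (real s + 1) < t" using N by (simp add: inverse_eq_divide add.commute)
      then have sub: "near n (1 / (real s + 1)) x \<subseteq> {k. \<forall>i\<in>{1..n}. \<forall>j\<in>{1..n}. i < j \<longrightarrow>
            dist ((T ^^ k) (x i)) ((T ^^ k) (x j)) < t}"
        unfolding near_def using order_less_trans by blast
      show "often s {k. \<forall>i\<in>{1..n}. \<forall>j\<in>{1..n}. i < j \<longrightarrow>
            dist ((T ^^ k) (x i)) ((T ^^ k) (x j)) < t}"
        using often_mono[OF often(2) sub] s by simp
    qed
  qed (rule \<phi>(1))
  then show ?thesis
    using mycielski_subset_range[OF \<open>inj \<phi>\<close> \<phi>(1,3)] \<phi>(2) d(1) by blast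
qed

lemma point_off_periodic_orbit:
  assumes "non_periodic X T" "p \<in> periodic_points X T"
  shows "\<exists>q\<in>X. q \<notin> forward_orbit T p"
proof -
  have "p \<in> X" using assms(2) by (simp add: periodic_points_def)
  then have "forward_orbit T p \<subseteq> X" by (auto simp: forward_orbit_def funpow_in)
  moreover have "X \<noteq> forward_orbit T p" using assms unfolding non_periodic_def by blast
  ultimately show ?thesis by blast
qed

lemma scrambled_set_fixed_point:
  assumes "topologically_transitive X T" "non_periodic X T" "shadowing X T" "fixed_points X T \<noteq> {}"
  shows "\<exists>K. mycielski_subset X K \<and> X \<subseteq> closure K \<and>
           (\<forall>n\<ge>2. \<exists>\<delta>>0. distributionally_scrambled X T n \<delta> K)"
proof -
  obtain p where p: "p \<in> fixed_points X T" using assms(4) by blast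
  then have "p \<in> periodic_points X T"
    unfolding fixed_points_def periodic_points_def by (auto intro!: exI[of _ 1])
  then obtain q where q: "q \<in> X" "q \<notin> forward_orbit T p"
    using point_off_periodic_orbit[OF assms(2)] by blast
  show ?thesis
    by (rule dense_scrambled_mycielski_set[OF assms(1,3) anchored_fixed_point[OF assms(1) p] q])
qed

lemma scrambled_set_periodic_point:
  assumes "topologically_transitive X T" "non_periodic X T" "shadowing X T" "periodic_points X T \<noteq> {}"
  shows "\<exists>K. mycielski_subset X K \<and> (\<forall>n\<ge>2. \<exists>\<delta>>0. distributionally_scrambled X T n \<delta> K)"
proof -
  obtain p where p: "p \<in> periodic_points X T" using assms(4) by blast
  then obtain P where P: "p \<in> X" "P \<ge> 1" "(T ^^ P) p = p" by (auto simp: periodic_points_def)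
  obtain q where q: "q \<in> X" "q \<notin> forward_orbit T p"
    using point_off_periodic_orbit[OF assms(2) p] by blast
  have "P > 0" using P(2) by simp
  then obtain D p' where D: "anchored D p' P" "forward_orbit T p' = forward_orbit T p"
    using anchored_periodic_point[OF assms(1) P(1) _ P(3)] by blast
  have "q \<notin> forward_orbit T p'" using q(2) D(2) by simp
  from dense_scrambled_mycielski_set[OF assms(1,3) D(1) q(1) this] show ?thesis by blast
qed

text \<open>
A periodic orbit is a finite set, and in a finite space a point has no other points close to it.
\<close>

lemma sensitive_imp_non_periodic:
  assumes "sensitive X T"
  shows "non_periodic X T"
  unfolding non_periodic_def
proof
  assume "\<exists>p\<in>periodic_points X T. X = forward_orbit T p"
  then obtain p where p: "p \<in> periodic_points X T" "X = forward_orbit T p" by blast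
  then obtain P where P: "P \<ge> 1" "(T ^^ P) p = p" by (auto simp: periodic_points_def)
  then have "finite X" using finite_forward_orbit[of P T p] p(2) by simp
  obtain x where x: "x \<in> X" using nonempty by blast
  obtain e where e: "e > 0" "\<forall>y\<in>X. y \<noteq> x \<longrightarrow> e \<le> dist x y"
    using finite_set_avoid[OF \<open>finite X\<close>, of x] by blast
  obtain \<delta> where \<delta>: "\<delta> > 0" "\<forall>x\<in>X. \<forall>\<epsilon>>0. \<exists>y\<in>X. dist x y < \<epsilon> \<and> (\<exists>k\<ge>1. dist ((T ^^ k) x) ((T ^^ k) y) > \<delta>)"
    using assms unfolding sensitive_def by blast
  obtain y k where y: "y \<in> X" "dist x y < e" "dist ((T ^^ k) x) ((T ^^ k) y) > \<delta>"
    using \<delta>(2) x e(1) by blast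
  have "y = x" using e(2) y by force
  then show False using y(3) \<delta>(1) by simp
qed

end

lemma limsup_close_frequency:
  assumes "upper_density {k. dist ((T ^^ k) x) ((T ^^ k) y) < t} = 1"
  shows "limsup (\<lambda>n. ereal (close_frequency T n x y t)) = 1"
proof -
  have "{i. i < n \<and> dist ((T ^^ i) x) ((T ^^ i) y) < t} = {k. dist ((T ^^ k) x) ((T ^^ k) y) < t} \<inter> {..<n}" for n
    by auto
  then show ?thesis using assms by (simp add: close_frequency_def upper_density_def)
qed

text \<open>
The times at distance less than \<open>d\<close> and those at distance more than \<open>d\<close> are disjoint, so the two
frequencies add up to at most one.
\<close>

lemma liminf_close_frequency:
  assumes "upper_density {k. dist ((T ^^ k) x) ((T ^^ k) y) > d} = 1"
  shows "liminf (\<lambda>n. ereal (close_frequency T n x y d)) = 0"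
proof (rule antisym)
  show "0 \<le> liminf (\<lambda>n. ereal (close_frequency T n x y d))"
    by (intro Liminf_bounded always_eventually allI) (simp add: close_frequency_def)
  let ?A = "{k. dist ((T ^^ k) x) ((T ^^ k) y) > d}"
  have le: "close_frequency T n x y d + real (card (?A \<inter> {..<n})) / real n \<le> 1" for n
  proof -
    let ?B = "{i. i < n \<and> dist ((T ^^ i) x) ((T ^^ i) y) < d}"
    have "card ?B + card (?A \<inter> {..<n}) = card (?B \<union> (?A \<inter> {..<n}))"
      by (subst card_Un_disjoint) auto
    also have "\<dots> \<le> card {..<n}" by (intro card_mono) auto
    finally have "real (card ?B) + real (card (?A \<inter> {..<n})) \<le> real n" by simp
    then show ?thesis
      by (cases "n = 0") (simp_all add: close_frequency_def flip: add_divide_distrib)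
  qed
  show "liminf (\<lambda>n. ereal (close_frequency T n x y d)) \<le> 0"
  proof (rule ccontr)
    assume "\<not> ?thesis"
    then have "0 < liminf (\<lambda>n. ereal (close_frequency T n x y d))" by simp
    then obtain c where c: "0 < ereal c" "ereal c < liminf (\<lambda>n. ereal (close_frequency T n x y d))"
      using ereal_dense2 by blast
    have "eventually (\<lambda>n. ereal c < ereal (close_frequency T n x y d)) sequentially"
      using c(2) by (rule less_LiminfD)
    then have "eventually (\<lambda>n. ereal (real (card (?A \<inter> {..<n})) / real n) \<le> ereal (1 - c)) sequentially"
    proof eventually_elim
      case (elim n)
      then show ?case using le[of n] by simp
    qed
    then have "upper_density ?A \<le> ereal (1 - c)"
      unfolding upper_density_def by (rule Limsup_bounded)
    then have "ereal 1 \<le> ereal (1 - c)" using assms by (simp add: one_ereal_def)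
    then show False using c(1) by simp
  qed
qed

lemma scrambled_imp_distributionally_chaotic:
  assumes K: "mycielski_subset X K" and \<delta>: "\<delta> > 0" and scr: "distributionally_scrambled X T 2 \<delta> K"
  shows "distributionally_chaotic X T"
  unfolding distributionally_chaotic_def
proof (intro exI[of _ K] conjI ballI impI allI)
  show "K \<subseteq> X" using scr by (simp add: distributionally_scrambled_def)
  obtain C where "cantor_subset X C" "C \<subseteq> K" using K unfolding mycielski_subset_def by blast
  then show "uncountable K" using uncountable_cantor_subset countable_subset by blast
  fix x y assume xy: "x \<in> K" "y \<in> K" "x \<noteq> y"
  define z where "z i = (if i = (1::nat) then x else y)" for i
  have z: "z ` {1..2} \<subseteq> K" "inj_on z {1..2}" using xy by (auto simp: z_def inj_on_def)
  have pair: "(\<forall>i\<in>{1..2}. \<forall>j\<in>{1..2}. i < j \<longrightarrow> R (z i) (z j)) \<longleftrightarrow> R x y" for R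
  proof -
    have "{1..2::nat} = {1, 2}" by auto
    then show ?thesis by (simp add: z_def)
  qed
  from scr[unfolded distributionally_scrambled_def] z
  have dens: "t > 0 \<Longrightarrow> upper_density {k. \<forall>i\<in>{1..2}. \<forall>j\<in>{1..2}. i < j \<longrightarrow>
           dist ((T ^^ k) (z i)) ((T ^^ k) (z j)) < t} = 1"
       "upper_density {k. \<forall>i\<in>{1..2}. \<forall>j\<in>{1..2}. i < j \<longrightarrow>
           dist ((T ^^ k) (z i)) ((T ^^ k) (z j)) > \<delta>} = 1" for t
    by blast+
  show "limsup (\<lambda>n. ereal (close_frequency T n x y t)) = 1" if "t > 0" for t
    using dens(1)[OF that] unfolding pair[of "\<lambda>a b. dist ((T ^^ k) a) ((T ^^ k) b) < t" for k]
    by (rule limsup_close_frequency)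
  show "\<exists>\<delta>>0. liminf (\<lambda>n. ereal (close_frequency T n x y \<delta>)) = 0"
    using dens(2) \<delta> unfolding pair[of "\<lambda>a b. dist ((T ^^ k) a) ((T ^^ k) b) > \<delta>" for k]
    by (intro exI[of _ \<delta>] conjI liminf_close_frequency)
qed

theorem theorem1p1:
  fixes X :: "'a::metric_space set" and T :: "'a \<Rightarrow> 'a"
  assumes "dynamical_system X T"
  shows
    "(topologically_transitive X T \<and> non_periodic X T \<and> shadowing X T \<longrightarrow>
        (fixed_points X T \<noteq> {} \<longrightarrow>
           (\<exists>K. mycielski_subset X K \<and> X \<subseteq> closure K \<and>
              (\<forall>n\<ge>2. \<exists>\<delta>>0. distributionally_scrambled X T n \<delta> K))) \<and>
        (periodic_points X T \<noteq> {} \<longrightarrow>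
           (\<exists>K. mycielski_subset X K \<and>
              (\<forall>n\<ge>2. \<exists>\<delta>>0. distributionally_scrambled X T n \<delta> K)))) \<and>
     (devaney_chaotic X T \<and> shadowing X T \<longrightarrow> distributionally_chaotic X T)"
proof -
  interpret dyn_system X T by standard (rule assms)
  show ?thesis
  proof (intro conjI impI; elim conjE)
    assume "devaney_chaotic X T" and shad: "shadowing X T"
    then have trans: "topologically_transitive X T" and np: "non_periodic X T"
      and dense: "X \<subseteq> closure (periodic_points X T)"
      by (auto simp: devaney_chaotic_def intro: sensitive_imp_non_periodic)
    have "periodic_points X T \<noteq> {}"
      using dense nonempty by auto
    then obtain K where K: "mycielski_subset X K" "\<forall>n\<ge>2. \<exists>\<delta>>0. distributionally_scrambled X T n \<delta> K"
      using scrambled_set_periodic_point[OF trans np shad] by blast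
    then obtain \<delta> where "\<delta> > 0" "distributionally_scrambled X T 2 \<delta> K" by blast
    then show "distributionally_chaotic X T"
      using scrambled_imp_distributionally_chaotic[OF K(1)] by blast
  qed (rule scrambled_set_fixed_point scrambled_set_periodic_point; assumption)+
qed

end
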